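(* Let $X$ be a connected square-tiled surface such that all vertices of the squares are singularities of the flat metric, and let $\alpha\in(0,1)$ be irrational with bounded partial quotients. Then the square-tiled interval exchange transformation $T_\alpha$ associated with $X$ (with normalized Lebesgue measure) is not of rank one.
   Context: A square-tiled surface is obtained from finitely many unit squares labelled $1,\dots,d$ by gluing, by translations, the right side of square $i$ to the left side of square $\tau(i)$ and the top side of square $i$ to the bottom side of square $\sigma(i)$, where $\tau,\sigma$ are permutations of $\{1,\dots,d\}$. It is connected if and only if the group generated by $\tau,\sigma$ acts transitively on $\{1,\dots,d\}$. A point of the surface coming from a vertex of a square has total angle $2k\pi$ for some integer $k\ge 1$; it is a singularity of the flat metric if $k>1$. The values of $k$ are the lengths of the cycles of the commutator of $\tau$ and $\sigma$, so all vertices are singularities if and only if $\tau\sigma(i)\ne\sigma\tau(i)$ for every $i\in\{1,\dots,d\}$. For $\alpha\in(0,1)$, write $\alpha=\frac{1}{1+\tan\theta}$ with $\tan\theta>0$. The square-tiled interval exchange transformation $T_\alpha$ is the first return map of the linear flow in direction $\theta$ to the union of the diagonals of slope $-1$ of the squares, the length of each diagonal being normalized to $1$. Concretely, $T_\alpha$ acts on $[0,1[\times\{1,\dots,d\}$ by $T_\alpha(x,i)=(x+\alpha \bmod 1,\ \phi_x(i))$, where $\phi_x=\sigma$ if $x\in[0,1-\alpha[$ and $\phi_x=\tau$ if $x\in[1-\alpha,1[$. It preserves the normalized Lebesgue measure $\mu$. A Rokhlin tower is a collection of pairwise disjoint measurable sets $F,TF,\dots,T^{h-1}F$ (its levels).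 A system $(X,T,\mu)$ is of rank one if there is a sequence of Rokhlin towers $F_n,TF_n,\dots,T^{h_n-1}F_n$ such that the partitions $\{F_n,TF_n,\dots,T^{h_n-1}F_n,X\setminus\bigcup_{j=0}^{h_n-1}T^jF_n\}$ generate the whole $\sigma$-algebra, in the sense that for every measurable set $A$ there are sets $A_n$, each a union of atoms of the $n$-th partition, with $\mu(A\,\Delta\,A_n)\to0$. An irrational number has bounded partial quotients if the partial quotients of its continued fraction expansion form a bounded sequence. *)

theory Defs
  imports "HOL-Analysis.Analysis" "HOL-Combinatorics.Permutations"
begin

section \<open>Square-tiled surfaces\<close>

definition square_tiling :: "nat \<Rightarrow> (nat \<Rightarrow> nat) \<Rightarrow> (nat \<Rightarrow> nat) \<Rightarrow> bool" where
  "square_tiling d \<tau> \<sigma> \<longleftrightarrow> d \<ge> 1 \<and> \<tau> permutes {1..d} \<and> \<sigma> permutes {1..d}"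

text \<open>The point \<open>(i, x, y)\<close> is the point with coordinates \<open>(x, y)\<close> in the \<open>i\<close>-th square.\<close>

definition squares :: "nat \<Rightarrow> (nat \<times> real \<times> real) set" where
  "squares d = {1..d} \<times> {0..1} \<times> {0..1}"

definition side_gluing ::
    "nat \<Rightarrow> (nat \<Rightarrow> nat) \<Rightarrow> (nat \<Rightarrow> nat) \<Rightarrow> (nat \<times> real \<times> real) rel" where
  "side_gluing d \<tau> \<sigma> =
     {((i, 1, y), (\<tau> i, 0, y)) | i y. i \<in> {1..d} \<and> y \<in> {0..1}} \<union>
     {((i, x, 1), (\<sigma> i, x, 0)) | i x. i \<in> {1..d} \<and> x \<in> {0..1}}"

definition gluing ::
    "nat \<Rightarrow> (nat \<Rightarrow> nat) \<Rightarrow> (nat \<Rightarrow> nat) \<Rightarrow> (nat \<times> real \<times> real) rel" where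
  "gluing d \<tau> \<sigma> = (side_gluing d \<tau> \<sigma> \<union> (side_gluing d \<tau> \<sigma>)\<inverse>)\<^sup>*"

definition surface ::
    "nat \<Rightarrow> (nat \<Rightarrow> nat) \<Rightarrow> (nat \<Rightarrow> nat) \<Rightarrow> (nat \<times> real \<times> real) set set" where
  "surface d \<tau> \<sigma> = squares d // gluing d \<tau> \<sigma>"

text \<open>The quotient topology; see \<open>quotient_map_surface\<close> below.\<close>

definition surface_topology ::
    "nat \<Rightarrow> (nat \<Rightarrow> nat) \<Rightarrow> (nat \<Rightarrow> nat) \<Rightarrow> (nat \<times> real \<times> real) set topology" where
  "surface_topology d \<tau> \<sigma> =
     topology (\<lambda>U. U \<subseteq> surface d \<tau> \<sigma> \<and> openin (top_of_set (squares d)) (\<Union>U))"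

definition connected_surface :: "nat \<Rightarrow> (nat \<Rightarrow> nat) \<Rightarrow> (nat \<Rightarrow> nat) \<Rightarrow> bool" where
  "connected_surface d \<tau> \<sigma> \<longleftrightarrow> connected_space (surface_topology d \<tau> \<sigma>)"

definition vertices ::
    "nat \<Rightarrow> (nat \<Rightarrow> nat) \<Rightarrow> (nat \<Rightarrow> nat) \<Rightarrow> (nat \<times> real \<times> real) set set" where
  "vertices d \<tau> \<sigma> = {P \<in> surface d \<tau> \<sigma>. P \<inter> {1..d} \<times> {0, 1} \<times> {0, 1} \<noteq> {}}"

text \<open>A square contributes to the angle at a point of the surface \<open>pi / 2\<close> for each of its
  corners, \<open>pi\<close> for each point in the interior of a side, and \<open>2 * pi\<close> for each interior point
  that projects to that point.\<close>

definition total_angle :: "(nat \<times> real \<times> real) set \<Rightarrow> real" where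
  "total_angle P = (\<Sum>(i, x, y)\<in>P.
     2 * pi * (if x \<in> {0, 1} then 1/2 else 1) * (if y \<in> {0, 1} then 1/2 else 1))"

definition singularities ::
    "nat \<Rightarrow> (nat \<Rightarrow> nat) \<Rightarrow> (nat \<Rightarrow> nat) \<Rightarrow> (nat \<times> real \<times> real) set set" where
  "singularities d \<tau> \<sigma> = {P \<in> surface d \<tau> \<sigma>. total_angle P > 2 * pi}"


section \<open>Square-tiled interval exchange transformations\<close>

definition sti_space :: "nat \<Rightarrow> (real \<times> nat) measure" where
  "sti_space d = restrict_space lborel {0..<1} \<Otimes>\<^sub>M uniform_count_measure {1..d}"

definition sti_map ::
    "real \<Rightarrow> (nat \<Rightarrow> nat) \<Rightarrow> (nat \<Rightarrow> nat) \<Rightarrow> real \<times> nat \<Rightarrow> real \<times> nat" where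
  "sti_map \<alpha> \<tau> \<sigma> = (\<lambda>(x, i). (frac (x + \<alpha>), if x < 1 - \<alpha> then \<sigma> i else \<tau> i))"


section \<open>Rank one\<close>

definition rokhlin_tower :: "'a measure \<Rightarrow> ('a \<Rightarrow> 'a) \<Rightarrow> 'a set \<Rightarrow> nat \<Rightarrow> bool" where
  "rokhlin_tower M T F h \<longleftrightarrow>
     h \<ge> 1 \<and> (\<forall>j<h. (T ^^ j) ` F \<in> sets M) \<and> disjoint_family_on (\<lambda>j. (T ^^ j) ` F) {..<h}"

definition tower_partition :: "'a measure \<Rightarrow> ('a \<Rightarrow> 'a) \<Rightarrow> 'a set \<Rightarrow> nat \<Rightarrow> 'a set set" where
  "tower_partition M T F h =
     insert (space M - (\<Union>j<h. (T ^^ j) ` F)) ((\<lambda>j. (T ^^ j) ` F) ` {..<h})"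

definition rank_one :: "'a measure \<Rightarrow> ('a \<Rightarrow> 'a) \<Rightarrow> bool" where
  "rank_one M T \<longleftrightarrow>
     (\<exists>F h. (\<forall>n. rokhlin_tower M T (F n) (h n)) \<and>
       (\<forall>A\<in>sets M. \<exists>S. (\<forall>n. S n \<subseteq> tower_partition M T (F n) (h n)) \<and>
          (\<lambda>n. measure M (sym_diff A (\<Union>(S n)))) \<longlonglongrightarrow> 0))"


section \<open>Bounded partial quotients\<close>

text \<open>The partial quotients \<open>a\<^sub>0, a\<^sub>1, \<dots>\<close> are the integer parts of the complete quotients
  \<open>x\<^sub>0 = x\<close>, \<open>x\<^sub>n\<^sub>+\<^sub>1 = 1 / (x\<^sub>n - a\<^sub>n)\<close>. For irrational \<open>x\<close> the expansion does not terminate.\<close>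

definition partial_quotient :: "real \<Rightarrow> nat \<Rightarrow> int" where
  "partial_quotient x n = \<lfloor>((\<lambda>y. 1 / frac y) ^^ n) x\<rfloor>"

definition bounded_partial_quotients :: "real \<Rightarrow> bool" where
  "bounded_partial_quotients x \<longleftrightarrow> (\<exists>K. \<forall>n. \<bar>partial_quotient x n\<bar> \<le> K)"


section \<open>Sanity checks\<close>

lemma equiv_gluing: "equiv UNIV (gluing d \<tau> \<sigma>)"
  unfolding gluing_def
  by (intro equivI refl_rtrancl trans_rtrancl sym_rtrancl) (auto simp: sym_Un_converse)

lemma side_gluing_squares:
  assumes "square_tiling d \<tau> \<sigma>" "(p, q) \<in> side_gluing d \<tau> \<sigma>"
  shows "p \<in> squares d \<and> q \<in> squares d"
proof -
  have "\<tau> i \<in> {1..d} \<longleftrightarrow> i \<in> {1..d}" "\<sigma> i \<in> {1..d} \<longleftrightarrow> i \<in> {1..d}" for i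
    using assms(1) by (simp_all add: square_tiling_def permutes_in_image del: atLeastAtMost_iff)
  then show ?thesis
    using assms(2) unfolding side_gluing_def squares_def
    by (elim UnE CollectE exE conjE) (simp_all del: One_nat_def)
qed

lemma gluing_closed:
  assumes "(p, q) \<in> gluing d \<tau> \<sigma>" "p \<in> S"
    and "\<And>p q. (p, q) \<in> side_gluing d \<tau> \<sigma> \<Longrightarrow> p \<in> S \<longleftrightarrow> q \<in> S"
  shows "q \<in> S"
  using assms(1) unfolding gluing_def
proof (induction rule: rtrancl_induct)
  case base
  show ?case by (rule assms(2))
next
  case (step r s)
  then show ?case using assms(3)[of r s] assms(3)[of s r] by blast
qed

lemma gluing_sides:
  "i \<in> {1..d} \<Longrightarrow> y \<in> {0..1} \<Longrightarrow> ((i, 1, y), (\<tau> i, 0, y)) \<in> gluing d \<tau> \<sigma>"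
  "i \<in> {1..d} \<Longrightarrow> x \<in> {0..1} \<Longrightarrow> ((i, x, 1), (\<sigma> i, x, 0)) \<in> gluing d \<tau> \<sigma>"
  unfolding gluing_def side_gluing_def by (auto intro!: r_into_rtrancl)

lemma gluing_squares:
  assumes "square_tiling d \<tau> \<sigma>" "(p, q) \<in> gluing d \<tau> \<sigma>" "p \<in> squares d"
  shows "q \<in> squares d"
  by (rule gluing_closed[OF assms(2,3)]) (use side_gluing_squares[OF assms(1)] in blast)

lemma openin_surface_topology:
  "openin (surface_topology d \<tau> \<sigma>) U \<longleftrightarrow>
     U \<subseteq> surface d \<tau> \<sigma> \<and> openin (top_of_set (squares d)) (\<Union>U)"
proof -
  have disj: "\<Union>(S \<inter> T) = \<Union>S \<inter> \<Union>T" if "S \<subseteq> surface d \<tau> \<sigma>" "T \<subseteq> surface d \<tau> \<sigma>" for S T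
  proof -
    have "surface d \<tau> \<sigma> \<subseteq> UNIV // gluing d \<tau> \<sigma>"
      unfolding surface_def quotient_def by auto
    then have "A = B" if "A \<in> S" "B \<in> T" "x \<in> A" "x \<in> B" for A B x
      using quotient_disj[OF equiv_gluing, of A d \<tau> \<sigma> B] that
        \<open>S \<subseteq> surface d \<tau> \<sigma>\<close> \<open>T \<subseteq> surface d \<tau> \<sigma>\<close> by blast
    then show ?thesis by blast
  qed
  have "istopology (\<lambda>U. U \<subseteq> surface d \<tau> \<sigma> \<and> openin (top_of_set (squares d)) (\<Union>U))"
    unfolding istopology_def
  proof (intro conjI allI impI; (elim conjE)?)
    fix S T assume "S \<subseteq> surface d \<tau> \<sigma>" "T \<subseteq> surface d \<tau> \<sigma>"
      "openin (top_of_set (squares d)) (\<Union>S)" "openin (top_of_set (squares d)) (\<Union>T)"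
    then show "openin (top_of_set (squares d)) (\<Union>(S \<inter> T))"
      by (simp only: disj openin_Int)
  next
    fix K :: "(nat \<times> real \<times> real) set set set"
    assume K: "\<forall>k\<in>K. k \<subseteq> surface d \<tau> \<sigma> \<and> openin (top_of_set (squares d)) (\<Union>k)"
    have "\<Union>(\<Union>K) = \<Union>(Union ` K)" by blast
    then show "openin (top_of_set (squares d)) (\<Union>(\<Union>K))"
      using K by (metis (no_types, lifting) imageE openin_Union)
  qed auto
  then show ?thesis
    unfolding surface_topology_def by (simp add: topology_inverse')
qed

lemma Union_surface:
  assumes "square_tiling d \<tau> \<sigma>" shows "\<Union>(surface d \<tau> \<sigma>) = squares d"
proof
  show "\<Union>(surface d \<tau> \<sigma>) \<subseteq> squares d"
    using gluing_squares[OF assms] unfolding surface_def quotient_def by blast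
  show "squares d \<subseteq> \<Union>(surface d \<tau> \<sigma>)"
  proof
    fix p assume "p \<in> squares d"
    moreover have "p \<in> gluing d \<tau> \<sigma> `` {p}"
      by (rule equiv_class_self[OF equiv_gluing]) simp
    ultimately show "p \<in> \<Union>(surface d \<tau> \<sigma>)"
      unfolding surface_def quotient_def by blast
  qed
qed

lemma topspace_surface:
  assumes "square_tiling d \<tau> \<sigma>"
  shows "topspace (surface_topology d \<tau> \<sigma>) = surface d \<tau> \<sigma>"
proof -
  have "openin (surface_topology d \<tau> \<sigma>) (surface d \<tau> \<sigma>)"
    by (simp add: openin_surface_topology Union_surface[OF assms])
  then show ?thesis
    by (meson openin_subset openin_surface_topology openin_topspace subset_antisym)
qed

lemma quotient_map_surface:
  assumes "square_tiling d \<tau> \<sigma>"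
  shows "quotient_map (top_of_set (squares d)) (surface_topology d \<tau> \<sigma>)
           (\<lambda>p. gluing d \<tau> \<sigma> `` {p})"
  unfolding quotient_map_def
proof (intro conjI allI impI)
  show "(\<lambda>p. gluing d \<tau> \<sigma> `` {p}) ` topspace (top_of_set (squares d)) =
    topspace (surface_topology d \<tau> \<sigma>)"
    unfolding topspace_surface[OF assms] by (auto simp: surface_def quotient_def)
next
  fix U assume "U \<subseteq> topspace (surface_topology d \<tau> \<sigma>)"
  then have U: "U \<subseteq> surface d \<tau> \<sigma>" by (simp add: topspace_surface[OF assms])
  have "{p \<in> squares d. gluing d \<tau> \<sigma> `` {p} \<in> U} = \<Union>U"
  proof (intro equalityI subsetI)
    fix p assume "p \<in> {p \<in> squares d. gluing d \<tau> \<sigma> `` {p} \<in> U}"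
    then show "p \<in> \<Union>U" using equiv_class_self[OF equiv_gluing, of p] by blast
  next
    fix p assume "p \<in> \<Union>U"
    then obtain P where P: "P \<in> U" "p \<in> P" by blast
    then obtain q where "q \<in> squares d" "P = gluing d \<tau> \<sigma> `` {q}"
      using U unfolding surface_def quotient_def by blast
    then have "gluing d \<tau> \<sigma> `` {p} = P" "p \<in> squares d"
      using P equiv_class_eq[OF equiv_gluing, of q p] gluing_squares[OF assms] by auto
    then show "p \<in> {p \<in> squares d. gluing d \<tau> \<sigma> `` {p} \<in> U}" using P by simp
  qed
  then show "openin (top_of_set (squares d))
      {x \<in> topspace (top_of_set (squares d)). gluing d \<tau> \<sigma> `` {x} \<in> U} =
      openin (surface_topology d \<tau> \<sigma>) U"
    by (simp add: openin_surface_topology U)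
qed

lemma connected_surface_iff:
  assumes st: "square_tiling d \<tau> \<sigma>"
  shows "connected_surface d \<tau> \<sigma> \<longleftrightarrow>
    (\<forall>I \<subseteq> {1..d}. I \<noteq> {} \<and> \<tau> ` I \<subseteq> I \<and> \<sigma> ` I \<subseteq> I \<longrightarrow> I = {1..d})"
proof (intro iffI allI impI)
  let ?X = "surface_topology d \<tau> \<sigma>" and ?q = "\<lambda>p. gluing d \<tau> \<sigma> `` {p}"
  fix I assume con: "connected_surface d \<tau> \<sigma>" and sub: "I \<subseteq> {1..d}"
    and I: "I \<noteq> {} \<and> \<tau> ` I \<subseteq> I \<and> \<sigma> ` I \<subseteq> I"
  have fin: "finite I" using sub finite_subset by blast
  have inj: "inj \<tau>" "inj \<sigma>" using st permutes_inj unfolding square_tiling_def by auto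
  have "\<tau> ` I = I" "\<sigma> ` I = I"
    using I fin inj by (meson endo_inj_surj inj_on_subset subset_UNIV)+
  then have mem: "\<tau> i \<in> I \<longleftrightarrow> i \<in> I" "\<sigma> i \<in> I \<longleftrightarrow> i \<in> I" for i
    using inj by (metis inj_image_mem_iff)+
  have step: "fst p \<in> I \<longleftrightarrow> fst q \<in> I" if "(p, q) \<in> side_gluing d \<tau> \<sigma>" for p q
    using that unfolding side_gluing_def by (auto simp: mem)
  have cls: "fst p \<in> I \<longleftrightarrow> fst q \<in> I" if "(p, q) \<in> gluing d \<tau> \<sigma>" for p q
    using gluing_closed[OF that, of "{p. fst p \<in> I}"]
      gluing_closed[OF that, of "{p. fst p \<notin> I}"] step by blast
  define V where "V J = ?q ` (J \<times> {0..1} \<times> {0..1})" for J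
  have VU: "{p \<in> squares d. ?q p \<in> V J} = J \<times> {0..1} \<times> {0..1}"
    if J: "J = I \<or> J = {1..d} - I" for J
  proof (intro equalityI subsetI)
    fix p assume "p \<in> {p \<in> squares d. ?q p \<in> V J}"
    then obtain r where r: "p \<in> squares d" "?q p = ?q r" "r \<in> J \<times> {0..1} \<times> {0..1}"
      unfolding V_def by auto
    then have "(p, r) \<in> gluing d \<tau> \<sigma>"
      using eq_equiv_class[OF _ equiv_gluing] by blast
    then show "p \<in> J \<times> {0..1} \<times> {0..1}" using cls[of p r] r J
      by (auto simp: squares_def)
  next
    fix p assume "p \<in> J \<times> {0..1::real} \<times> {0..1::real}"
    then show "p \<in> {p \<in> squares d. ?q p \<in> V J}" using J sub
      unfolding V_def squares_def by auto
  qed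
  have opn: "openin ?X (V J)" if J: "J = I \<or> J = {1..d} - I" for J
  proof -
    have sV: "V J \<subseteq> topspace ?X" using J sub
      unfolding V_def topspace_surface[OF st] surface_def quotient_def squares_def by auto
    have "open (J \<times> UNIV \<times> (UNIV :: real set) :: (nat \<times> real \<times> real) set)"
      by (intro open_Times) (auto simp: open_discrete)
    moreover have "J \<times> {0..1} \<times> {0..1} = squares d \<inter> (J \<times> UNIV \<times> UNIV)"
      using J sub unfolding squares_def by auto
    ultimately have "openin (top_of_set (squares d)) (J \<times> {0..1} \<times> {0..1})"
      unfolding openin_open by blast
    then have "openin (top_of_set (squares d))
        {p \<in> topspace (top_of_set (squares d)). ?q p \<in> V J}"
      by (simp add: VU[OF J])
    then show ?thesis using quotient_map_surface[OF st] sV unfolding quotient_map_def by blast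
  qed
  have un: "topspace ?X \<subseteq> V I \<union> V ({1..d} - I)"
    unfolding V_def topspace_surface[OF st] surface_def quotient_def squares_def by force
  have int: "V I \<inter> V ({1..d} - I) = {}"
  proof (rule ccontr)
    assume "V I \<inter> V ({1..d} - I) \<noteq> {}"
    then obtain p where "p \<in> I \<times> {0..1::real} \<times> {0..1::real}" "?q p \<in> V ({1..d} - I)"
      unfolding V_def by blast
    then have "p \<in> {p \<in> squares d. ?q p \<in> V ({1..d} - I)}" using sub by (auto simp: squares_def)
    then show False using VU[of "{1..d} - I"] \<open>p \<in> I \<times> {0..1} \<times> {0..1}\<close> by auto
  qed
  have "V I \<noteq> {}" using I by (auto simp: V_def)
  with con opn un int have "V ({1..d} - I) = {}"
    unfolding connected_surface_def connected_space_def by blast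
  then show "I = {1..d}" using sub by (auto simp: V_def)
next
  let ?X = "surface_topology d \<tau> \<sigma>" and ?q = "\<lambda>p. gluing d \<tau> \<sigma> `` {p}"
  assume tr: "\<forall>I \<subseteq> {1..d}. I \<noteq> {} \<and> \<tau> ` I \<subseteq> I \<and> \<sigma> ` I \<subseteq> I \<longrightarrow> I = {1..d}"
  have perm: "\<tau> i \<in> {1..d}" "\<sigma> i \<in> {1..d}" if "i \<in> {1..d}" for i
    using st that permutes_in_image[of \<tau> "{1..d}"] permutes_in_image[of \<sigma> "{1..d}"]
    unfolding square_tiling_def by auto
  define Q where "Q i = ?q ` ({i} \<times> {0..1} \<times> {0..1})" for i
  have conQ: "connectedin ?X (Q i)" if "i \<in> {1..d}" for i
  proof -
    have "connected ({i} \<times> {0..1} \<times> {0..1} :: (nat \<times> real \<times> real) set)"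
      by (intro connected_Times) auto
    then have "connectedin (top_of_set (squares d)) ({i} \<times> {0..1} \<times> {0..1})"
      using that by (auto simp: connectedin_subtopology squares_def)
    then show ?thesis unfolding Q_def
      using connectedin_continuous_map_image quotient_imp_continuous_map quotient_map_surface[OF st]
      by blast
  qed
  define C where "C = connected_component_of_set ?X (?q (1, 0, 0))"
  define I where "I = {i \<in> {1..d}. Q i \<subseteq> C}"
  have absorb: "Q j \<subseteq> C" if "j \<in> {1..d}" "P \<in> Q j" "P \<in> C" for P j
    using connected_component_of_maximal[OF conQ[OF that(1)] that(2)] that(3)
    unfolding C_def by (metis connected_component_of_equiv mem_Collect_eq)
  have top1: "?q (1, 0, 0) \<in> Q 1" by (auto simp: Q_def)
  have one: "1 \<in> {1..d}" using st by (simp add: square_tiling_def)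
  have "?q (1, 0, 0) \<in> C" using top1 connectedin_subset_topspace[OF conQ[OF one]]
    unfolding C_def by (auto simp: connected_component_of_refl)
  then have "1 \<in> I" using absorb[OF one top1] one by (simp add: I_def)
  moreover have "\<tau> i \<in> I" if "i \<in> I" for i
  proof -
    have i: "i \<in> {1..d}" "Q i \<subseteq> C" using that by (auto simp: I_def)
    have "?q (i, 1, 0) = ?q (\<tau> i, 0, 0)"
      using equiv_class_eq[OF equiv_gluing gluing_sides(1)] i(1) by simp
    moreover have "?q (i, 1, 0) \<in> Q i" "?q (\<tau> i, 0, 0) \<in> Q (\<tau> i)" by (auto simp: Q_def)
    ultimately have "Q (\<tau> i) \<subseteq> C" using absorb[OF perm(1)[OF i(1)]] i(2) by (metis subsetD)
    then show ?thesis using perm(1)[OF i(1)] by (simp add: I_def)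
  qed
  moreover have "\<sigma> i \<in> I" if "i \<in> I" for i
  proof -
    have i: "i \<in> {1..d}" "Q i \<subseteq> C" using that by (auto simp: I_def)
    have "?q (i, 0, 1) = ?q (\<sigma> i, 0, 0)"
      using equiv_class_eq[OF equiv_gluing gluing_sides(2)] i(1) by simp
    moreover have "?q (i, 0, 1) \<in> Q i" "?q (\<sigma> i, 0, 0) \<in> Q (\<sigma> i)" by (auto simp: Q_def)
    ultimately have "Q (\<sigma> i) \<subseteq> C" using absorb[OF perm(2)[OF i(1)]] i(2) by (metis subsetD)
    then show ?thesis using perm(2)[OF i(1)] by (simp add: I_def)
  qed
  ultimately have "I \<noteq> {} \<and> \<tau> ` I \<subseteq> I \<and> \<sigma> ` I \<subseteq> I" by auto
  moreover have "I \<subseteq> {1..d}" by (auto simp: I_def)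
  ultimately have "I = {1..d}" using tr[rule_format, of I] by fast
  then have QC: "Q i \<subseteq> C" if "i \<in> {1..d}" for i using that by (auto simp: I_def)
  have "topspace ?X \<subseteq> C"
  proof
    fix P assume "P \<in> topspace ?X"
    then obtain i x y where "(i, x, y) \<in> squares d" "P = ?q (i, x, y)"
      unfolding topspace_surface[OF st] surface_def quotient_def by auto
    then show "P \<in> C" using QC[of i] by (auto simp: squares_def Q_def)
  qed
  moreover have "connectedin ?X C" unfolding C_def by (rule connectedin_connected_component_of)
  ultimately show "connected_surface d \<tau> \<sigma>"
    unfolding connected_surface_def
    by (metis connectedin_subset_topspace connectedin_topspace subset_antisym)
qed

lemma vertices_singular_iff:
  assumes st: "square_tiling d \<tau> \<sigma>"
  shows "vertices d \<tau> \<sigma> \<subseteq> singularities d \<tau> \<sigma> \<longleftrightarrow> (\<forall>i\<in>{1..d}. \<tau> (\<sigma> i) \<noteq> \<sigma> (\<tau> i))"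
proof (intro iffI ballI)
  let ?q = "\<lambda>p. gluing d \<tau> \<sigma> `` {p}"
  have inj: "inj \<tau>" "inj \<sigma>" using st permutes_inj unfolding square_tiling_def by auto
  fix i assume sing: "vertices d \<tau> \<sigma> \<subseteq> singularities d \<tau> \<sigma>" and i: "i \<in> {1..d}"
  show "\<tau> (\<sigma> i) \<noteq> \<sigma> (\<tau> i)"
  proof
    assume comm: "\<tau> (\<sigma> i) = \<sigma> (\<tau> i)"
    define S :: "(nat \<times> real \<times> real) set"
      where "S = {(i, 1, 1), (\<tau> i, 0, 1), (\<sigma> i, 1, 0), (\<sigma> (\<tau> i), 0, 0)}"
    have step: "p \<in> S \<longleftrightarrow> q \<in> S" if "(p, q) \<in> side_gluing d \<tau> \<sigma>" for p q
    proof -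
      have eqs: "\<tau> k = \<sigma> (\<tau> i) \<longleftrightarrow> k = \<sigma> i" "\<tau> k = \<tau> i \<longleftrightarrow> k = i"
        "\<sigma> k = \<sigma> l \<longleftrightarrow> k = l" for k l
        using inj comm by (metis injD)+
      show ?thesis
        using that unfolding side_gluing_def S_def by (elim UnE CollectE exE conjE) (simp_all add: eqs)
    qed
    have sub: "?q (i, 1, 1) \<subseteq> S"
      using gluing_closed[of "(i, 1, 1)" _ d \<tau> \<sigma> S] step by (auto simp: S_def)
    have "(i, 1, 1) \<in> ?q (i, 1, 1)" by (rule equiv_class_self[OF equiv_gluing]) simp
    moreover have "?q (i, 1, 1) \<in> surface d \<tau> \<sigma>"
      using i unfolding surface_def squares_def by (auto intro!: quotientI)
    ultimately have "?q (i, 1, 1) \<in> vertices d \<tau> \<sigma>"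
      using i unfolding vertices_def by blast
    then have "total_angle (?q (i, 1, 1)) > 2 * pi"
      using sing by (auto simp: singularities_def)
    moreover have "total_angle (?q (i, 1, 1)) \<le> total_angle S"
      unfolding total_angle_def by (intro sum_mono2 sub) (auto simp: S_def)
    moreover have "total_angle S = 2 * pi"
      unfolding total_angle_def S_def by simp
    ultimately show False by simp
  qed
next
  let ?q = "\<lambda>p. gluing d \<tau> \<sigma> `` {p}"
  assume nc: "\<forall>i\<in>{1..d}. \<tau> (\<sigma> i) \<noteq> \<sigma> (\<tau> i)"
  have perm: "\<tau> i \<in> {1..d}" "\<sigma> i \<in> {1..d}" if "i \<in> {1..d}" for i
    using st that permutes_in_image[of \<tau> "{1..d}"] permutes_in_image[of \<sigma> "{1..d}"]
    unfolding square_tiling_def by auto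
  have pre: "\<exists>j\<in>{1..d}. i = \<tau> j" "\<exists>j\<in>{1..d}. i = \<sigma> j" if "i \<in> {1..d}" for i
    using st that permutes_image[of \<tau> "{1..d}"] permutes_image[of \<sigma> "{1..d}"]
    unfolding square_tiling_def by blast+
  show "vertices d \<tau> \<sigma> \<subseteq> singularities d \<tau> \<sigma>"
  proof
    fix P assume P: "P \<in> vertices d \<tau> \<sigma>"
    then have surf: "P \<in> surface d \<tau> \<sigma>" by (simp add: vertices_def)
    obtain k x y where k: "k \<in> {1..d}" "x \<in> {0, 1}" "y \<in> {0, 1}" "(k, x, y) \<in> P"
      using P unfolding vertices_def by blast
    have cls: "P = ?q p" if "p \<in> P" for p
      using surf that equiv_class_eq[OF equiv_gluing] unfolding surface_def quotient_def
      by fastforce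
    have trans: "q \<in> P \<longleftrightarrow> p \<in> P" if "(p, q) \<in> gluing d \<tau> \<sigma>" for p q
      using that cls equiv_class_eq[OF equiv_gluing that] equiv_class_self[OF equiv_gluing]
      by (metis UNIV_I)
    have "\<exists>i\<in>{1..d}. (i, 1, y) \<in> P"
      using k pre(1)[OF k(1)] trans[OF gluing_sides(1)[of _ d y \<tau> \<sigma>]]
      by auto
    then obtain j where j: "j \<in> {1..d}" "(j, 1, y) \<in> P" by blast
    have "\<exists>i\<in>{1..d}. (i, 1, 1) \<in> P"
      using k(3) j pre(2)[OF j(1)] trans[OF gluing_sides(2)[of _ d 1 \<sigma> \<tau>]]
      by auto
    then obtain i where i: "i \<in> {1..d}" "(i, 1, 1) \<in> P" by blast
    define S :: "(nat \<times> real \<times> real) set" where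
      "S = {(i, 1, 1), (\<tau> i, 0, 1), (\<sigma> (\<tau> i), 0, 0), (\<sigma> i, 1, 0), (\<tau> (\<sigma> i), 0, 0)}"
    have a: "(\<tau> i, 0, 1) \<in> P" using trans[OF gluing_sides(1)[OF i(1), of 1]] i(2) by simp
    have b: "(\<sigma> (\<tau> i), 0, 0) \<in> P"
      using trans[OF gluing_sides(2)[OF perm(1)[OF i(1)], of 0]] a by simp
    have c: "(\<sigma> i, 1, 0) \<in> P" using trans[OF gluing_sides(2)[OF i(1), of 1]] i(2) by simp
    have e: "(\<tau> (\<sigma> i), 0, 0) \<in> P"
      using trans[OF gluing_sides(1)[OF perm(2)[OF i(1)], of 0]] c by simp
    have SP: "S \<subseteq> P" using i a b c e by (simp add: S_def)
    have step: "p \<in> {1..d} \<times> {0, 1} \<times> {0, 1} \<longleftrightarrow> q \<in> {1..d} \<times> {0, 1} \<times> {0, 1}"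
      if "(p, q) \<in> side_gluing d \<tau> \<sigma>" for p q
      using that perm unfolding side_gluing_def
      by (elim UnE CollectE exE conjE) (simp_all del: atLeastAtMost_iff)
    have corner: "P \<subseteq> {1..d} \<times> {0, 1} \<times> {0, 1}"
    proof
      fix p assume "p \<in> P"
      then have "((i, 1, 1), p) \<in> gluing d \<tau> \<sigma>" using cls[OF i(2)] by blast
      then show "p \<in> {1..d} \<times> {0, 1} \<times> {0, 1}"
        by (rule gluing_closed) (use i(1) step in blast)+
    qed
    have "finite P" by (rule finite_subset[OF corner]) auto
    then have "total_angle S \<le> total_angle P"
      unfolding total_angle_def by (intro sum_mono2 SP) auto
    moreover have "total_angle S = 5 * (pi / 2)"
    proof -
      have "\<tau> (\<sigma> i) \<noteq> \<sigma> (\<tau> i)" using nc i(1) by blast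
      then show ?thesis unfolding total_angle_def S_def by simp
    qed
    ultimately have "2 * pi < total_angle P" using pi_gt_zero by linarith
    then show "P \<in> singularities d \<tau> \<sigma>"
      using surf unfolding singularities_def by simp
  qed
qed

lemma space_sti_space: "space (sti_space d) = {0..<1} \<times> {1..d}"
  by (simp add: sti_space_def space_pair_measure space_restrict_space space_uniform_count_measure)

lemma emeasure_sti_space:
  assumes "d \<ge> 1" shows "emeasure (sti_space d) (space (sti_space d)) = 1"
proof -
  let ?M = "restrict_space lborel {0..<1 :: real}" and ?N = "uniform_count_measure {1..d}"
  have N: "emeasure ?N {1..d} = 1"
    using assms by (subst emeasure_uniform_count_measure) auto
  have M: "emeasure ?M {0..<1} = 1"
    by (subst emeasure_restrict_space) auto
  have "emeasure ?N {1..d} \<noteq> \<infinity>"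
    unfolding N by simp
  then have "emeasure ?N (space ?N) \<noteq> \<infinity>"
    unfolding space_uniform_count_measure .
  then interpret N: finite_measure ?N
    by (rule finite_measureI)
  have A: "{0..<1} \<in> sets ?M"
    by (subst sets_restrict_space_iff) auto
  have B: "{1..d} \<in> sets ?N"
    unfolding sets_uniform_count_measure by (rule Pow_top)
  have "emeasure (?M \<Otimes>\<^sub>M ?N) ({0..<1} \<times> {1..d}) = 1"
    unfolding N.emeasure_pair_measure_Times[OF A B] M N by simp
  then show ?thesis
    unfolding space_sti_space unfolding sti_space_def .
qed

end

theory Submission
  imports Defs "HOL-Number_Theory.Cong"
begin

text \<open>Two orbits in the same fibre whose base points differ by \<open>\<delta>\<close> keep or lose the equality of their
  labels only when they pass on different sides of a vertex; there one applies \<open>\<tau> \<circ> \<sigma>\<close> and the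
  other \<open>\<sigma> \<circ> \<tau>\<close>, so equal labels become different. Because \<open>\<alpha>\<close> is badly approximable, such passages
  are separated by times of order \<open>1 / \<delta>\<close>. Hence two orbit segments of length \<open>h\<close> whose labels mostly
  agree have base points at distance \<open>O(1 / h)\<close>.

  Suppose now that a Rokhlin tower of height \<open>h\<close> covers almost everything and almost determines the
  label. Take two points at distance \<open>\<rho>\<close>, of order \<open>1 / h\<close>, whose labels agree for a time \<open>6 h\<close> and
  differ during the following \<open>7 h\<close>, and whose orbits are typical for the tower. A visit of one orbit
  to the base of the tower and a nearby visit of the other, at an offset \<open>s\<close> in time, yield segments
  with the same labels, so \<open>s \<alpha>\<close> is within \<open>O(1 / h)\<close> of an integer. Successive offsets differ by at
  most a small multiple of \<open>h\<close>, hence are equal, again because \<open>\<alpha>\<close> is badly approximable. So the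
  levels \<open>j\<close> and \<open>j + s\<close> of the tower carry the same label (read before time \<open>6 h\<close>) and different
  labels (read after it).\<close>

section \<open>Badly approximable numbers\<close>

lemma partial_quotient_Suc: "partial_quotient x (Suc n) = partial_quotient (1 / frac x) n"
  unfolding partial_quotient_def by (simp only: funpow_Suc_right o_apply)

lemma frac_irrational:
  fixes y :: real
  assumes "y \<notin> \<rat>"
  shows "0 < frac y" "frac y < 1" "1 / frac y \<notin> \<rat>"
proof -
  have "frac y \<notin> \<rat>"
  proof
    assume "frac y \<in> \<rat>"
    then have "frac y + of_int \<lfloor>y\<rfloor> \<in> \<rat>" by (intro Rats_add) auto
    then show False using assms by (simp add: frac_def)
  qed
  then show "1 / frac y \<notin> \<rat>"
    by (metis Rats_inverse inverse_eq_divide inverse_inverse_eq)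
  show "0 < frac y" using \<open>frac y \<notin> \<rat>\<close> frac_ge_0[of y] by (metis Rats_0 order_less_le)
  show "frac y < 1" by (rule frac_lt_1)
qed

lemma complete_quotient_less:
  assumes "\<And>n. n \<ge> 1 \<Longrightarrow> partial_quotient y n \<le> K"
  shows "1 / frac y < of_int K + 1"
proof -
  have "\<lfloor>1 / frac y\<rfloor> \<le> K"
    using assms[of 1] by (simp add: partial_quotient_def)
  then show ?thesis by linarith
qed

text \<open>The quadratic form in \<open>q\<close> and \<open>\<theta> = q y - p\<close> is chosen so that one step of the Gauss map
  sends it to a form of the same shape, with a parameter that is again in \<open>[0, 1]\<close>.\<close>

lemma quadratic_form_lower_bound:
  fixes y m :: real and q :: nat and p K :: int
  assumes "y \<notin> \<rat>" "\<And>n. n \<ge> 1 \<Longrightarrow> partial_quotient y n \<le> K" "K \<ge> 1" "q \<ge> 1" "0 \<le> m" "m \<le> 1"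
    "\<bar>q * y - p\<bar> \<le> 1/2"
  shows "1 / (4 * (of_int K + 1)\<^sup>2) \<le> \<bar>q * y - p\<bar> * (q - m * (q * y - p))"
  using assms
proof (induction q arbitrary: y p m rule: less_induct)
  case (less q)
  define k :: real where "k = of_int K + 1"
  have k: "k \<ge> 2" using less.prems(3) by (simp add: k_def)
  define \<theta> where "\<theta> = q * y - p"
  \<comment> \<open>\<open>y'\<close> is the next complete quotient. As
    \<open>\<theta> = (q - p' * y') / y'\<close>, the approximation of \<open>y'\<close> to study
    next has denominator \<open>p'\<close> and numerator \<open>q\<close>.\<close>
  define y' where "y' = 1 / frac y"
  define p' where "p' = p - q * \<lfloor>y\<rfloor>"
  define \<theta>' where "\<theta>' = p' * y' - q"
  have y': "y' > 1" "y' < k" "y' \<notin> \<rat>"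
    using frac_irrational[OF less.prems(1)] complete_quotient_less[OF less.prems(2)]
    by (auto simp: y'_def k_def)
  have pq': "\<And>n. n \<ge> 1 \<Longrightarrow> partial_quotient y' n \<le> K"
    unfolding y'_def partial_quotient_Suc[symmetric] using less.prems(2) by simp
  have \<theta>\<theta>': "\<theta> = - \<theta>' / y'"
    using frac_irrational(1)[OF less.prems(1)]
    by (simp add: \<theta>_def \<theta>'_def y'_def p'_def frac_def field_simps)
  have \<theta>: "\<bar>\<theta>\<bar> \<le> 1/2" using less.prems(7) by (simp add: \<theta>_def)
  have "m * \<theta> \<le> m * \<bar>\<theta>\<bar>" using less.prems(5) by (intro mult_left_mono) auto
  also have "\<dots> \<le> 1 * (1/2)"
    using \<theta> less.prems(5,6) by (intro mult_mono) auto
  finally have "m * \<theta> \<le> 1/2" by simp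
  then have half: "1/2 \<le> q - m * \<theta>"
    using less.prems(4) by linarith
  \<comment> \<open>The second factor of the form is at least 1/2, so this bound settles every case
    in which \<theta> is not too small.\<close>
  have large: "1 / (4 * k\<^sup>2) \<le> \<bar>\<theta>\<bar> * (q - m * \<theta>)" if "1 / (2 * k\<^sup>2) \<le> \<bar>\<theta>\<bar>"
    using mult_mono[OF that half] by simp
  have kk: "1 / (2 * k\<^sup>2) \<le> 1 / (2 * k)"
    using k by (simp add: power2_eq_square field_simps)
  have "1 / (4 * k\<^sup>2) \<le> \<bar>\<theta>\<bar> * (q - m * \<theta>)"
  proof (cases "\<bar>\<theta>'\<bar> \<le> 1/2 \<and> p' \<ge> 1")
    \<comment> \<open>No descent to \<open>p'\<close> here, but \<open>\<theta>'\<close> is large: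
      either by assumption or because \<open>p' * y' \<le> 0\<close> while
      \<open>q \<ge> 1\<close>.\<close>
    case False
    have "\<bar>\<theta>'\<bar> \<ge> 1/2"
    proof (cases "p' \<ge> 1")
      case True
      then show ?thesis using False by linarith
    next
      case neg: False
      then have "p' * y' \<le> 0" using y'(1) by (simp add: mult_nonpos_nonneg)
      then show ?thesis using less.prems(4) unfolding \<theta>'_def by linarith
    qed
    then have "(1/2) / k \<le> \<bar>\<theta>'\<bar> / y'"
      using y' by (intro frac_le) auto
    then show ?thesis using large kk y' by (simp add: \<theta>\<theta>')
  next
    case True
    have "frac y' * k > 1"
      using complete_quotient_less[OF pq'] frac_irrational[OF y'(3)]
      by (simp add: k_def field_simps)
    then have "frac y' > 1 / k" using k by (simp add: field_simps)
    moreover have "y' \<ge> 1 + frac y'"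
      using y'(1) by (simp add: frac_def)
    ultimately have y'1: "y' - 1 \<ge> 1 / k" by linarith
    have "p' \<le> q"
    proof (rule ccontr)
      assume "\<not> p' \<le> q"
      then have "real_of_int p' \<ge> q + 1" by linarith
      moreover have "p' * y' \<ge> real_of_int p' * 1" using True y'(1) by (intro mult_left_mono) auto
      moreover have "\<bar>p' * y' - q\<bar> \<le> 1/2" using True by (simp add: \<theta>'_def)
      ultimately show False by linarith
    qed
    show ?thesis
    proof (cases "p' = q")
      \<comment> \<open>The denominator does not decrease, so the induction hypothesis is out of
        reach. But now \<open>\<theta>' = q * (y' - 1)\<close>, which the bound on the partial
        quotients of \<open>y'\<close> keeps away from 0.\<close>
      case eq: True
      have "q * (y' - 1) \<ge> 1 * (1 / k)"
        using y'1 less.prems(4) k by (intro mult_mono) auto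
      then have "\<bar>\<theta>'\<bar> \<ge> 1 / k" by (simp add: \<theta>'_def eq algebra_simps)
      then have "(1 / k) / k \<le> \<bar>\<theta>'\<bar> / y'"
        using y' k by (intro frac_le) auto
      moreover have "1 / (2 * k\<^sup>2) \<le> (1 / k) / k"
        using k by (simp add: power2_eq_square field_simps)
      ultimately show ?thesis using large y' by (simp add: \<theta>\<theta>')
    next
      case False
      define q' where "q' = nat p'"
      have q': "q' < q" "q' \<ge> 1" "int q' = p'"
        using False \<open>p' \<le> q\<close> True by (auto simp: q'_def)
      \<comment> \<open>The value for which
        \<open>p' - m' * \<theta>' = (q - m * \<theta>) / y'\<close>. Since
        \<open>\<bar>\<theta>'\<bar> = y' * \<bar>\<theta>\<bar>\<close>, the form keeps its
        value.\<close>
      define m' where "m' = (1 - m / y') / y'"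
      have "m / y' \<le> 1" using y'(1) less.prems(6) by (simp add: field_simps)
      then have m': "0 \<le> m'" "m' \<le> 1"
        using y'(1) less.prems(5) by (auto simp: m'_def divide_le_eq_1 intro: order.trans[of _ 1])
      have "1 / (4 * k\<^sup>2) \<le> \<bar>q' * y' - int q\<bar> * (q' - m' * (q' * y' - int q))"
        unfolding k_def using True q'
        by (intro less.IH[OF q'(1) y'(3) pq' less.prems(3) q'(2) m'])
           (auto simp: \<theta>'_def)
      also have "\<dots> = \<bar>\<theta>'\<bar> * (p' - m' * \<theta>')"
        using q'(3) by (auto simp: \<theta>'_def)
      also have "p' - m' * \<theta>' = (q - m * \<theta>) / y'"
        using y'(1) by (simp add: \<theta>\<theta>' m'_def \<theta>'_def field_simps)
      finally show ?thesis using y'(1) by (simp add: \<theta>\<theta>')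
    qed
  qed
  then show ?case by (simp add: \<theta>_def k_def)
qed

text \<open>For \<open>m = 0\<close> the quadratic form is \<open>q * \<bar>q * y - p\<bar>\<close>,
  and its lower bound is bad approximability. Distances above 1/2 are covered by
  \<open>c \<le> 1/4\<close>.\<close>

lemma bounded_partial_quotients_imp_badly_approximable:
  fixes \<alpha> :: real
  assumes "\<alpha> \<notin> \<rat>" "bounded_partial_quotients \<alpha>"
  obtains c :: real where "0 < c" "c \<le> 1/4"
    "\<And>(k::nat) (n::int). k \<ge> 1 \<Longrightarrow> c / k \<le> \<bar>k * \<alpha> - n\<bar>"
proof -
  obtain K where K: "\<And>n. \<bar>partial_quotient \<alpha> n\<bar> \<le> K"
    using assms(2) by (auto simp: bounded_partial_quotients_def)
  define L where "L = max K 1"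
  define c :: real where "c = 1 / (4 * (of_int L + 1)\<^sup>2)"
  have L: "L \<ge> 1" "\<And>n. partial_quotient \<alpha> n \<le> L"
    using K unfolding L_def by (auto simp: abs_le_iff intro: le_max_iff_disj[THEN iffD2])
  have "(of_int L + 1 :: real)\<^sup>2 \<ge> 1\<^sup>2" using L(1) by (intro power_mono) auto
  then have "1 / (of_int L + 1 :: real)\<^sup>2 \<le> 1" by (simp add: divide_le_eq_1)
  moreover have "1 / (of_int L + 1 :: real)\<^sup>2 > 0" using L(1) by simp
  ultimately have c: "0 < c" "c \<le> 1/4" by (auto simp: c_def)
  have "c / k \<le> \<bar>k * \<alpha> - n\<bar>" if k: "k \<ge> 1" for k :: nat and n :: int
    proof (cases "\<bar>k * \<alpha> - n\<bar> \<le> 1/2")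
      case True
      have "c \<le> \<bar>k * \<alpha> - n\<bar> * k"
        using quadratic_form_lower_bound[OF assms(1) L(2) L(1) k, of 0 n] True
        by (simp add: c_def)
      then show ?thesis using k by (simp add: field_simps)
    next
      case False
      have "c / k \<le> c / 1" using k c by (intro divide_left_mono) auto
      then show ?thesis using False c by simp
    qed
  then show thesis by (intro that[OF c]) auto
qed

section \<open>Hitting times of arcs under the rotation by \<alpha>\<close>

locale badly_approximable =
  fixes \<alpha> c :: real
  assumes c: "0 < c" "c \<le> 1/4"
    and approx: "\<And>(k::nat) (n::int). k \<ge> 1 \<Longrightarrow> c / k \<le> \<bar>k * \<alpha> - n\<bar>"
begin

lemma approx_int:
  fixes s n :: int and b :: real
  assumes "s \<noteq> 0" "\<bar>s\<bar> \<le> b"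
  shows "c / b \<le> \<bar>s * \<alpha> - n\<bar>"
proof -
  have "c / b \<le> c / nat \<bar>s\<bar>"
    using assms c by (intro divide_left_mono) auto
  also have "\<dots> \<le> \<bar>s * \<alpha> - n\<bar>"
  proof (cases "s > 0")
    case True
    then show ?thesis using approx[of "nat s" n] by simp
  next
    case False
    then have "c / real (nat (- s)) \<le> \<bar>real (nat (- s)) * \<alpha> - of_int (- n)\<bar>"
      using assms(1) by (intro approx) auto
    then show ?thesis using False by (simp add: abs_minus_commute algebra_simps)
  qed
  finally show ?thesis .
qed

definition hit_const :: real where "hit_const = 4 / c"

text \<open>Dirichlet gives \<open>p / q\<close> with \<open>q \<le> Q\<close> and
  \<open>\<bar>q * \<alpha> - p\<bar> < 1 / Q\<close>; bad approximability forces
  \<open>q > c * Q \<ge> 3 / \<delta>\<close>. The rotation by \<open>p / q\<close> thus runs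
  through points spaced by less than \<open>\<delta> / 3\<close>, and for \<open>q\<close> steps the
  rotation by \<alpha> stays within \<open>1 / q\<close> of it.\<close>

lemma hits_arc:
  assumes "0 < \<delta>" "\<delta> \<le> 1"
  obtains j :: nat and n :: int
    where "j \<le> hit_const / \<delta>" "x + j * \<alpha> < n" "n \<le> x + \<delta> + j * \<alpha>"
proof -
  define Q where "Q = nat \<lceil>3 / (c * \<delta>)\<rceil>"
  have c\<delta>: "0 < c * \<delta>" "c * \<delta> \<le> 1" using assms c by (auto intro: mult_le_one)
  have Q: "Q \<ge> 3 / (c * \<delta>)" "Q \<le> 4 / (c * \<delta>)"
  proof -
    have "0 < 3 / (c * \<delta>)" using c\<delta> by simp
    moreover have "3 / (c * \<delta>) + 1 \<le> 4 / (c * \<delta>)" using c\<delta> by (simp add: field_simps)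
    ultimately show "Q \<ge> 3 / (c * \<delta>)" "Q \<le> 4 / (c * \<delta>)" unfolding Q_def by (smt (verit) of_nat_nat of_int_of_nat_eq zero_le_ceiling le_of_int_ceiling ceiling_correct of_int_ceiling_le_add_one)+
  qed
  have Qpos: "Q > 0" using Q(1) c\<delta> by (metis divide_pos_pos gr0I less_numeral_extra(3) of_nat_0 order_less_le_trans zero_less_numeral)
  obtain p q where pq: "coprime p q" "0 < q" "q \<le> int Q" "\<bar>of_int q * \<alpha> - of_int p\<bar> < 1 / Q"
    using Dirichlet_approx_coprime[OF Qpos, of \<alpha>] by auto
  have "c / q \<le> \<bar>of_int q * \<alpha> - of_int p\<bar>" using approx_int[of q "q" p] pq(2) by simp
  then have "c / q < 1 / Q" using pq(4) by linarith
  then have "c * Q < q" using pq(2) Qpos by (simp add: field_simps)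
  moreover have "3 / \<delta> \<le> c * Q" using Q(1) c assms by (simp add: field_simps)
  ultimately have "3 / \<delta> < q" by linarith
  then have q: "3 / q < \<delta>" using pq(2) assms by (simp add: field_simps)
  \<comment> \<open>The target \<open>- x - r / q\<close> lies in \<open>(1 / q, 2 / q]\<close>,
    which leaves room \<open>1 / q\<close> on either side for the error of the rational
    rotation.\<close>
  define r where "r = \<lceil>- x * q - 2\<rceil>"
  have r: "1 / q < - x - r / q" "- x - r / q \<le> 2 / q"
  proof -
    have "real_of_int r \<ge> - x * q - 2" "real_of_int r < - x * q - 1" unfolding r_def by linarith+
    then have "1 < (- x - r / q) * q" "(- x - r / q) * q \<le> 2"
      using pq(2) by (auto simp: left_diff_distrib)
    then show "1 / q < - x - r / q" "- x - r / q \<le> 2 / q"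
      using pq(2) by (simp_all add: pos_divide_less_eq pos_le_divide_eq)
  qed
  obtain w where w: "[p * w = 1] (mod q)" using cong_solve_coprime_int[OF pq(1)] by blast
  \<comment> \<open>\<open>w\<close> inverts \<open>p\<close> modulo \<open>q\<close>, so the
    rational rotation reaches the residue \<open>r\<close> at a time
    \<open>j < q \<le> Q\<close>.\<close>
  define j where "j = (w * r) mod q"
  have j: "0 \<le> j" "j < q" using pq(2) by (auto simp: j_def)
  have "[j * p = (w * r) * p] (mod q)" unfolding j_def by (intro cong_mult) (auto simp: cong_def)
  also have "[(w * r) * p = (p * w) * r] (mod q)" by (simp add: algebra_simps)
  also have "[(p * w) * r = 1 * r] (mod q)" by (intro cong_mult w) simp
  finally have "q dvd j * p - r" by (simp add: cong_iff_dvd_diff)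
  then obtain n where n: "j * p = r + q * n" by (metis dvdE diff_eq_eq add.commute)
  define e where "e = j * \<alpha> - j * p / q"
  have "e = (j / q) * (q * \<alpha> - p)" using pq(2) by (simp add: e_def field_simps)
  then have "\<bar>e\<bar> = (j / q) * \<bar>q * \<alpha> - p\<bar>" using j pq(2) by (simp add: abs_mult)
  also have "\<dots> \<le> 1 * (1 / Q)" using j pq by (intro mult_mono) auto
  also have "\<dots> \<le> 1 / q" using pq by (simp add: frac_le)
  finally have e: "\<bar>e\<bar> \<le> 1 / q" .
  have "real_of_int j * p = r + q * n" using n by (metis of_int_add of_int_mult)
  then have "j * \<alpha> = r / q + n + e" using pq(2) by (simp add: e_def field_simps)
  then have *: "n - x - j * \<alpha> = - x - r / q - e" by simp
  show thesis
  proof (rule that)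
    have "real_of_int j \<le> Q" using j pq(3) by linarith
    then show "nat j \<le> hit_const / \<delta>"
      using Q(2) j by (simp add: hit_const_def)
    show "x + nat j * \<alpha> < n" using * e r j by (simp add: abs_le_iff)
    have "3 / real_of_int q = 2 / q + 1 / q" by (simp add: field_simps)
    then show "n \<le> x + \<delta> + nat j * \<alpha>" using * e r j q by (simp add: abs_le_iff)
  qed
qed

end

section \<open>Labels of nearby orbits\<close>

text \<open>The label of the orbit of \<open>(frac x, i)\<close> after \<open>t\<close> steps, see
  \<open>funpow_sti_map\<close>. The base point is not reduced modulo 1: for \<alpha> in (0, 1),
  \<tau> is applied exactly when the lifted orbit passes an integer.\<close>

primrec fibre :: "real \<Rightarrow> (nat \<Rightarrow> nat) \<Rightarrow> (nat \<Rightarrow> nat) \<Rightarrow> real \<Rightarrow> nat \<Rightarrow> nat \<Rightarrow> nat" where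
  "fibre \<alpha> \<tau> \<sigma> x i 0 = i"
| "fibre \<alpha> \<tau> \<sigma> x i (Suc t) =
     (if \<lfloor>x + (t + 1) * \<alpha>\<rfloor> = \<lfloor>x + t * \<alpha>\<rfloor> then \<sigma> else \<tau>) (fibre \<alpha> \<tau> \<sigma> x i t)"

lemma fibre_add:
  "fibre \<alpha> \<tau> \<sigma> x i (t + s) = fibre \<alpha> \<tau> \<sigma> (x + t * \<alpha>) (fibre \<alpha> \<tau> \<sigma> x i t) s"
  by (induction s) (auto simp: algebra_simps)

lemma fibre_add_int: "fibre \<alpha> \<tau> \<sigma> (x + of_int n) i t = fibre \<alpha> \<tau> \<sigma> x i t"
proof -
  have "\<lfloor>x + of_int n + r\<rfloor> = \<lfloor>x + r\<rfloor> + n" for r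
    by (metis add.assoc add.commute floor_add_int)
  then show ?thesis by (induction t) auto
qed

lemma funpow_sti_map:
  assumes "0 < \<alpha>" "\<alpha> < 1"
  shows "(sti_map \<alpha> \<tau> \<sigma> ^^ t) (frac x, i) = (frac (x + t * \<alpha>), fibre \<alpha> \<tau> \<sigma> x i t)"
proof (induction t)
  case (Suc t)
  have "frac (frac y + \<alpha>) = frac (y + \<alpha>)" for y
    using assms by (simp add: frac_add frac_def floor_add)
  moreover have "frac y < 1 - \<alpha> \<longleftrightarrow> \<lfloor>y + \<alpha>\<rfloor> = \<lfloor>y\<rfloor>" for y
    using assms unfolding frac_def by linarith
  ultimately show ?case using Suc by (simp add: sti_map_def algebra_simps)
qed simp

text \<open>Models a vertex lying between the two orbits at time \<open>t\<close>: the integers are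
  the lifts of the ends of the diagonals.\<close>

definition crosses :: "real \<Rightarrow> real \<Rightarrow> real \<Rightarrow> nat \<Rightarrow> bool" where
  "crosses \<alpha> x \<delta> t \<longleftrightarrow> \<lfloor>x + \<delta> + t * \<alpha>\<rfloor> \<noteq> \<lfloor>x + t * \<alpha>\<rfloor>"

lemma crosses_iff:
  fixes \<alpha> x \<delta> :: real
  assumes "\<delta> > 0"
  shows "crosses \<alpha> x \<delta> t \<longleftrightarrow> (\<exists>n::int. x + t * \<alpha> < n \<and> n \<le> x + \<delta> + t * \<alpha>)"
proof
  assume "crosses \<alpha> x \<delta> t"
  then have "\<lfloor>x + t * \<alpha>\<rfloor> < \<lfloor>x + \<delta> + t * \<alpha>\<rfloor>"
    using assms floor_mono[of "x + t * \<alpha>" "x + \<delta> + t * \<alpha>"] by (simp add: crosses_def)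
  then show "\<exists>n::int. x + t * \<alpha> < n \<and> n \<le> x + \<delta> + t * \<alpha>"
    by (intro exI[of _ "\<lfloor>x + \<delta> + t * \<alpha>\<rfloor>"]) (simp add: floor_less_iff)
next
  assume "\<exists>n::int. x + t * \<alpha> < n \<and> n \<le> x + \<delta> + t * \<alpha>"
  then show "crosses \<alpha> x \<delta> t"
    unfolding crosses_def by (metis floor_less_iff le_floor_iff leD)
qed

section \<open>Crossings of a vertex and their effect on labels\<close>

locale badly_approximable_sti = badly_approximable \<alpha> c for \<alpha> c :: real +
  fixes d :: nat and \<tau> \<sigma> :: "nat \<Rightarrow> nat"
  assumes \<alpha>: "0 < \<alpha>" "\<alpha> < 1"
    and tiling: "square_tiling d \<tau> \<sigma>"
    and noncommuting: "\<And>i. i \<in> {1..d} \<Longrightarrow> \<tau> (\<sigma> i) \<noteq> \<sigma> (\<tau> i)"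
begin

abbreviation "lab \<equiv> fibre \<alpha> \<tau> \<sigma>"
abbreviation "cross \<equiv> crosses \<alpha>"

lemma lab_in: "i \<in> {1..d} \<Longrightarrow> lab x i t \<in> {1..d}"
proof (induction t)
  case (Suc t)
  then show ?case
    using tiling permutes_in_image[of \<tau> "{1..d}"] permutes_in_image[of \<sigma> "{1..d}"]
    unfolding square_tiling_def by (simp del: atLeastAtMost_iff)
qed simp

text \<open>Each crossing puts the orbit of \<open>x\<close> less than or exactly \<delta> below an
  integer, but not on it. Subtracting, \<open>(t' - t) * \<alpha>\<close> is less than \<delta> away
  from an integer, and bad approximability applies.\<close>

lemma cross_gap:
  assumes "\<delta> > 0" "cross x \<delta> t" "cross x \<delta> t'" "t < t'"
  shows "c / (t' - t) < \<delta>"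
proof -
  obtain n n' :: int where n: "x + t * \<alpha> < n" "n \<le> x + \<delta> + t * \<alpha>"
    "x + t' * \<alpha> < n'" "n' \<le> x + \<delta> + t' * \<alpha>"
    using assms(2,3) unfolding crosses_iff[OF assms(1)] by blast
  have "c / (t' - t) \<le> \<bar>real (t' - t) * \<alpha> - of_int (n' - n)\<bar>"
    using assms(4) approx[of "t' - t" "n' - n"] by simp
  also have "\<dots> < \<delta>"
    using n assms(4) by (simp add: abs_less_iff of_nat_diff algebra_simps)
  finally show ?thesis using assms(4) by (simp add: of_nat_diff)
qed

text \<open>With no integer between the orbits before and after the step, both apply the same
  permutation, which is injective.\<close>

lemma no_cross_step:
  assumes "\<not> cross x \<delta> t" "\<not> cross x \<delta> (Suc t)"
  shows "lab x i (Suc t) = lab (x + \<delta>) i' (Suc t) \<longleftrightarrow> lab x i t = lab (x + \<delta>) i' t"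
proof -
  have "inj \<tau>" "inj \<sigma>" using tiling permutes_inj unfolding square_tiling_def by auto
  then show ?thesis using assms by (auto simp: crosses_def inj_eq add.commute[of 1])
qed

lemma no_cross_interval:
  assumes "a \<le> b" "\<And>s. a \<le> s \<Longrightarrow> s \<le> b \<Longrightarrow> \<not> cross x \<delta> s"
  shows "lab x i b = lab (x + \<delta>) i' b \<longleftrightarrow> lab x i a = lab (x + \<delta>) i' a"
  using assms
proof (induction b rule: dec_induct)
  case (step n)
  then show ?case using no_cross_step[of x \<delta> n i i'] by simp
qed simp

text \<open>The two orbits pass on different sides of a vertex, so one applies
  \<open>\<tau> \<circ> \<sigma>\<close> and the other \<open>\<sigma> \<circ> \<tau>\<close>.\<close>

lemma cross_step:
  assumes "\<delta> > 0" "\<not> cross x \<delta> t" "cross x \<delta> (t + 1)" "\<not> cross x \<delta> (t + 2)"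
    and "i \<in> {1..d}" "lab x i t = lab (x + \<delta>) i' t"
  shows "lab x i (t + 2) \<noteq> lab (x + \<delta>) i' (t + 2)"
proof -
  define n n' where "n s = \<lfloor>x + real s * \<alpha>\<rfloor>" and "n' s = \<lfloor>x + \<delta> + real s * \<alpha>\<rfloor>" for s
  have step: "n s \<le> n (Suc s)" "n (Suc s) \<le> n s + 1" "n' s \<le> n' (Suc s)" "n' (Suc s) \<le> n' s + 1" for s
    using \<alpha> unfolding n_def n'_def by (simp_all add: algebra_simps; linarith)+
  \<comment> \<open>The orbit of \<open>x + \<delta>\<close> is ahead, and floors rise by at most 1
    per step: it passes the integer in the first step, the orbit of \<open>x\<close> in the
    second.\<close>
  have "n (t + 1) \<le> n' (t + 1)"
    using assms(1) unfolding n_def n'_def by (intro floor_mono) simp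
  moreover have "n' t = n t" "n' (t + 1) \<noteq> n (t + 1)" "n' (t + 2) = n (t + 2)"
    using assms(2-4) by (auto simp: crosses_def n_def n'_def)
  ultimately have *: "n (Suc t) = n t" "n' (Suc t) \<noteq> n' t" "n (Suc (Suc t)) \<noteq> n (Suc t)"
      "n' (Suc (Suc t)) = n' (Suc t)"
    using step[of t] step[of "Suc t"] by auto
  have "lab x i (t + 2) = \<tau> (\<sigma> (lab x i t))"
    using *(1,3) by (simp add: n_def algebra_simps)
  moreover have "lab (x + \<delta>) i' (t + 2) = \<sigma> (\<tau> (lab (x + \<delta>) i' t))"
    using *(2,4) by (simp add: n'_def algebra_simps)
  ultimately show ?thesis using assms(6) noncommuting[OF lab_in[OF assms(5), of x t]] by metis
qed

text \<open>Every window of length \<open>W\<close> contains a crossing with no other crossing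
  within \<open>g\<close> steps on either side. If the labels agree just before it, they differ for
  \<open>g\<close> steps after it; otherwise they already differ for \<open>g\<close> steps before
  it.\<close>

lemma window_disagreement:
  fixes \<delta> :: real and a g W :: nat
  assumes "0 < \<delta>" "\<delta> \<le> c / 8" "i \<in> {1..d}" "i' \<in> {1..d}"
  defines "g \<equiv> nat \<lfloor>c / \<delta>\<rfloor>" and "W \<equiv> 2 * nat \<lfloor>c / \<delta>\<rfloor> + nat \<lfloor>hit_const / \<delta>\<rfloor> + 1"
  shows "g \<le> card {t \<in> {a..<a + W}. lab x i t \<noteq> lab (x + \<delta>) i' t}"
proof -
  have g8: "g \<ge> 8" using assms(1,2) unfolding g_def by (simp add: le_nat_floor field_simps)
  have gle: "g \<le> c / \<delta>" using assms(1) c unfolding g_def by simp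
  \<comment> \<open>Starting the search at \<open>a + g\<close> keeps the \<open>g\<close> times
    before the crossing inside the window.\<close>
  obtain j :: nat and n :: int where j: "j \<le> hit_const / \<delta>"
      "x + (a + g) * \<alpha> + j * \<alpha> < n" "n \<le> x + (a + g) * \<alpha> + \<delta> + j * \<alpha>"
    using hits_arc[of \<delta> "x + (a + g) * \<alpha>"] assms(1,2) c by auto
  define t where "t = a + g + j"
  have t: "cross x \<delta> t"
    unfolding crosses_iff[OF assms(1)] t_def using j(2,3)
    by (intro exI[of _ n]) (simp add: algebra_simps)
  have ta: "a + g \<le> t" "t + g < a + W"
    using j(1) unfolding t_def W_def g_def by (auto simp: le_nat_floor less_Suc_eq_le)
  have nc: "\<not> cross x \<delta> s" if "s \<noteq> t" "t \<le> s + g" "s \<le> t + g" for s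
  proof
    assume s: "cross x \<delta> s"
    define k where "k = (if s < t then t - s else s - t)"
    have k: "1 \<le> k" "k \<le> g" using that by (auto simp: k_def)
    have "c / k < \<delta>"
      using cross_gap[OF assms(1) s t] cross_gap[OF assms(1) t s] that(1)
      by (cases "s < t") (auto simp: k_def of_nat_diff)
    moreover have "\<delta> \<le> c / g" using gle g8 assms(1) by (simp add: field_simps)
    moreover have "c / g \<le> c / k" using k c by (intro divide_left_mono) auto
    ultimately show False by linarith
  qed
  let ?D = "{t \<in> {a..<a + W}. lab x i t \<noteq> lab (x + \<delta>) i' t}"
  show ?thesis
  proof (cases "lab x i (t - 1) = lab (x + \<delta>) i' (t - 1)")
    case True
    have "\<not> cross x \<delta> (t - 1)" "cross x \<delta> (t - 1 + 1)" "\<not> cross x \<delta> (t - 1 + 2)"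
      using nc[of "t - 1"] nc[of "t - 1 + 2"] t ta g8 by auto
    from cross_step[OF assms(1) this assms(3) True]
    have ne: "lab x i (t + 1) \<noteq> lab (x + \<delta>) i' (t + 1)" using ta g8 by (simp add: numeral_2_eq_2)
    have "{t + 1..t + g} \<subseteq> ?D"
    proof
      fix s assume s: "s \<in> {t + 1..t + g}"
      have "lab x i s \<noteq> lab (x + \<delta>) i' s"
        using no_cross_interval[of "t + 1" s x \<delta> i i'] ne s nc by auto
      then show "s \<in> ?D" using s ta by auto
    qed
    then have "card {t + 1..t + g} \<le> card ?D" by (intro card_mono) auto
    then show ?thesis by simp
  next
    case False
    have "{t - g..<t} \<subseteq> ?D"
    proof
      fix s assume s: "s \<in> {t - g..<t}"
      have "s \<le> t - 1" using s by auto
      then have "lab x i s \<noteq> lab (x + \<delta>) i' s"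
        using no_cross_interval[of s "t - 1" x \<delta> i i'] False s nc ta by auto
      then show "s \<in> ?D" using s ta by auto
    qed
    then have "card {t - g..<t} \<le> card ?D" by (intro card_mono) auto
    then show ?thesis using ta by simp
  qed
qed

text \<open>Chosen so that the window length \<open>W\<close> is at most
  \<open>close_const / \<delta>\<close>; the summand 1 pays for the last 1 in \<open>W\<close>, as
  \<open>1 \<le> 1 / \<delta>\<close>.\<close>

definition close_const :: real where "close_const = hit_const + 2 * c + 1"

lemma close_const_pos: "close_const > 1"
  using c by (simp add: close_const_def hit_const_def add_pos_pos)

text \<open>Consecutive windows of length \<open>W\<close> fill at least half of
  \<open>{..<h}\<close>, and each contributes \<open>g \<ge> c / (2 * \<delta>)\<close>
  disagreements, to be compared with \<open>W \<le> close_const / \<delta>\<close>.\<close>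

lemma disagreement:
  fixes \<delta> :: real and h :: nat
  assumes "0 < \<delta>" "\<delta> \<le> c / 8" "i \<in> {1..d}" "i' \<in> {1..d}" "close_const / \<delta> \<le> h"
  shows "c / (4 * close_const) * h \<le> card {t. t < h \<and> lab x i t \<noteq> lab (x + \<delta>) i' t}"
proof -
  define g where "g = nat \<lfloor>c / \<delta>\<rfloor>"
  define W where "W = 2 * nat \<lfloor>c / \<delta>\<rfloor> + nat \<lfloor>hit_const / \<delta>\<rfloor> + 1"
  let ?D = "\<lambda>A. {t \<in> A. lab x i t \<noteq> lab (x + \<delta>) i' t}"
  have *: "k * g \<le> card (?D {..<k * W})" for k
  proof (induction k)
    case (Suc k)
    have "?D {..<Suc k * W} = ?D {..<k * W} \<union> ?D {k * W..<k * W + W}" by auto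
    moreover have "card (?D {..<k * W} \<union> ?D {k * W..<k * W + W}) =
        card (?D {..<k * W}) + card (?D {k * W..<k * W + W})"
      by (intro card_Un_disjoint) auto
    moreover have "g \<le> card (?D {k * W..<k * W + W})"
      unfolding g_def W_def by (rule window_disagreement[OF assms(1-4)])
    ultimately show ?case using Suc by simp
  qed simp
  have cd: "c / \<delta> \<ge> 8" using assms(1,2) by (simp add: field_simps)
  have "g \<ge> c / \<delta> - 1" using cd unfolding g_def by linarith
  then have g: "g \<ge> c / (2 * \<delta>)" using cd by (simp add: field_simps)
  have "real (nat \<lfloor>c / \<delta>\<rfloor>) \<le> c / \<delta>" "real (nat \<lfloor>hit_const / \<delta>\<rfloor>) \<le> hit_const / \<delta>" "1 \<le> 1 / \<delta>"
    using assms(1,2) c by (auto simp: hit_const_def)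
  then have W: "W \<le> close_const / \<delta>"
    unfolding W_def close_const_def add_divide_distrib by simp
  have W0: "W > 0" by (simp add: W_def)
  have Wh: "W \<le> h" using W assms(5) by linarith
  define k where "k = h div W"
  have "h = k * W + h mod W" by (simp add: k_def)
  moreover have "h mod W < W" using W0 by simp
  moreover have "k \<ge> 1" using Wh W0 by (simp add: k_def div_greater_zero_iff Suc_le_eq)
  then have "W \<le> k * W" by simp
  ultimately have "h \<le> 2 * (k * W)" by linarith
  then have "real h \<le> 2 * (real k * real W)" by (metis of_nat_le_iff of_nat_mult of_nat_numeral)
  also have "\<dots> \<le> 2 * (real k * (close_const / \<delta>))" using W by (intro mult_left_mono) auto
  finally have "real h * (c / (4 * close_const)) \<le> 2 * (real k * (close_const / \<delta>)) * (c / (4 * close_const))"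
    using c close_const_pos by (intro mult_right_mono) auto
  also have "\<dots> = real k * (c / (2 * \<delta>))" using close_const_pos assms(1) by (simp add: field_simps)
  also have "\<dots> \<le> real k * real g" using g by (intro mult_left_mono) auto
  also have "\<dots> \<le> card (?D {..<k * W})" using * by (metis of_nat_le_iff of_nat_mult)
  also have "\<dots> \<le> card (?D {..<h})"
    using \<open>h = k * W + h mod W\<close> by (intro of_nat_mono card_mono) auto
  also have "?D {..<h} = {t. t < h \<and> lab x i t \<noteq> lab (x + \<delta>) i' t}" by auto
  finally show ?thesis by (simp add: mult.commute)
qed

text \<open>Contrapositive of \<open>disagreement\<close>, applied from the smaller of
  \<open>u\<close> and \<open>v + n\<close>; the shift by an integer leaves the labels
  unchanged.\<close>

lemma agreement_imp_close:
  fixes u v :: real and n :: int and h :: nat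
  assumes "\<bar>u - v - n\<bar> \<le> c / 8" "i \<in> {1..d}" "i' \<in> {1..d}" "h > 0"
    and "card {t. t < h \<and> lab u i t \<noteq> lab v i' t} < c / (4 * close_const) * h"
  shows "\<bar>u - v - n\<bar> < close_const / h"
proof (rule ccontr)
  assume "\<not> ?thesis"
  then have ge: "close_const / h \<le> \<bar>u - v - n\<bar>" by simp
  define \<delta> where "\<delta> = \<bar>u - v - n\<bar>"
  have "0 < close_const / h" using close_const_pos assms(4) by simp
  then have \<delta>: "0 < \<delta>" "\<delta> \<le> c / 8"
    using ge assms(1) by (auto simp: \<delta>_def)
  then have \<delta>h: "close_const / \<delta> \<le> h"
    using ge assms(4) unfolding \<delta>_def[symmetric] by (simp add: field_simps)
  have v: "lab (v + of_int n) i' t = lab v i' t" for t by (rule fibre_add_int)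
  show False
  proof (cases "u - v - n > 0")
    case True
    then have "u = v + of_int n + \<delta>" by (simp add: \<delta>_def)
    then show False
      using disagreement[OF \<delta> assms(3,2) \<delta>h, of "v + of_int n"] assms(5) v
      by (simp add: eq_commute)
  next
    case False
    then have "v + of_int n = u + \<delta>" by (simp add: \<delta>_def)
    then show False
      using disagreement[OF \<delta> assms(2,3) \<delta>h, of u] assms(5) v by simp
  qed
qed

end

section \<open>Comparing two orbits through a common code of the tower levels\<close>

lemma floor_frac_eq_imp_close:
  fixes m p q :: real
  assumes "m > 0" "\<lfloor>m * frac p\<rfloor> = \<lfloor>m * frac q\<rfloor>"
  shows "\<bar>p - q - of_int (\<lfloor>p\<rfloor> - \<lfloor>q\<rfloor>)\<bar> < 1 / m"
proof -
  have "\<bar>m * frac p - m * frac q\<bar> < 1" using assms(2) by linarith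
  then have "m * \<bar>frac p - frac q\<bar> < 1"
    using assms(1) by (simp add: abs_mult flip: right_diff_distrib)
  then show ?thesis using assms(1) by (simp add: frac_def field_simps)
qed

lemma card_shift_le:
  fixes B :: "nat set"
  assumes "finite B"
  shows "card {j \<in> A. t + j \<in> B} \<le> card B"
  by (rule card_inj_on_le[of "\<lambda>j. t + j"]) (use assms in \<open>auto simp: inj_on_def\<close>)

text \<open>Serves to find one level of the tower at which two passages are both typical.\<close>

lemma exists_good_shift:
  fixes B :: "nat set"
  assumes "finite B" "finite A" "2 * card B < card A"
  obtains j where "j \<in> A" "t + j \<notin> B" "t' + j \<notin> B"
proof -
  have "card ({j \<in> A. t + j \<in> B} \<union> {j \<in> A. t' + j \<in> B}) \<le> card B + card B"
    using card_Un_le card_shift_le[OF assms(1)] by (meson add_mono order_trans)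
  then have "\<not> A \<subseteq> {j \<in> A. t + j \<in> B} \<union> {j \<in> A. t' + j \<in> B}"
    using assms card_mono[of "{j \<in> A. t + j \<in> B} \<union> {j \<in> A. t' + j \<in> B}" A] by auto
  then show thesis using that by blast
qed

context badly_approximable_sti
begin

text \<open>Two passages through the tower, begun at \<open>t\<close> and \<open>t'\<close>, read
  the same \<open>code\<close>, so their labels agree on all but at most \<open>2 * b\<close>
  levels. One level typical for both also shares its cell, which gives the distance
  \<open>1 / m \<le> c / 8\<close> required by \<open>agreement_imp_close\<close>.\<close>

lemma visits_imp_close:
  fixes h b t t' :: nat and m u v :: real and B :: "nat set"
  assumes "i \<in> {1..d}" "i' \<in> {1..d}" "m \<ge> 8 / c" "8 * close_const * b < c * h"
    and "finite B" "card B \<le> b"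
    and "\<And>j. j < h \<Longrightarrow> t + j \<notin> B \<Longrightarrow> code j = (\<lfloor>m * frac (u + (t + j) * \<alpha>)\<rfloor>, lab u i (t + j))"
    and "\<And>j. j < h \<Longrightarrow> t' + j \<notin> B \<Longrightarrow> code j = (\<lfloor>m * frac (v + (t' + j) * \<alpha>)\<rfloor>, lab v i' (t' + j))"
  obtains n :: int where "\<bar>u + t * \<alpha> - (v + t' * \<alpha>) - n\<bar> < close_const / h"
proof -
  have "8 / c > 0" using c by simp
  then have m: "m > 0" using assms(3) by linarith
  have m8: "1 / m \<le> c / 8"
    using assms(3) c m by (simp add: divide_simps mult.commute)
  have "1 * real b \<le> close_const * b" using close_const_pos by (intro mult_right_mono) auto
  moreover have "c * h \<le> 1 * real h" using c by (intro mult_right_mono) auto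
  ultimately have "8 * real b < h" using assms(4) by simp
  then have bh: "2 * card B < card {..<h}" "h > 0" using assms(6) by auto
  obtain k where k: "k < h" "t + k \<notin> B" "t' + k \<notin> B"
    using exists_good_shift[OF assms(5) _ bh(1), of t t'] by auto
  define n where "n = \<lfloor>u + (t + k) * \<alpha>\<rfloor> - \<lfloor>v + (t' + k) * \<alpha>\<rfloor>"
  have "\<bar>u + (t + k) * \<alpha> - (v + (t' + k) * \<alpha>) - n\<bar> < 1 / m"
    unfolding n_def by (rule floor_frac_eq_imp_close[OF m]) (use assms(7)[OF k(1,2)] assms(8)[OF k(1,3)] in simp)
  then have n: "\<bar>u + t * \<alpha> - (v + t' * \<alpha>) - n\<bar> \<le> c / 8"
    using m8 by (simp add: algebra_simps)
  let ?D = "{j. j < h \<and> lab (u + t * \<alpha>) (lab u i t) j \<noteq> lab (v + t' * \<alpha>) (lab v i' t') j}"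
  have "?D \<subseteq> {j \<in> {..<h}. t + j \<in> B} \<union> {j \<in> {..<h}. t' + j \<in> B}"
  proof
    fix j assume "j \<in> ?D"
    then have "j < h" "lab u i (t + j) \<noteq> lab v i' (t' + j)" by (auto simp: fibre_add)
    then show "j \<in> {j \<in> {..<h}. t + j \<in> B} \<union> {j \<in> {..<h}. t' + j \<in> B}"
      using assms(7)[of j] assms(8)[of j] by (cases "t + j \<in> B"; cases "t' + j \<in> B") auto
  qed
  then have "card ?D \<le> card ({j \<in> {..<h}. t + j \<in> B} \<union> {j \<in> {..<h}. t' + j \<in> B})"
    by (intro card_mono) auto
  also have "\<dots> \<le> card B + card B"
    using card_Un_le card_shift_le[OF assms(5)] by (meson add_mono order_trans)
  finally have "real (card ?D) \<le> 2 * b" using assms(6) by linarith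
  also have "\<dots> < c / (4 * close_const) * h"
    using assms(4) close_const_pos by (simp add: field_simps)
  finally show thesis
    using that agreement_imp_close[OF n lab_in[OF assms(1)] lab_in[OF assms(2)] bh(2)] by blast
qed

text \<open>\<open>S\<close> and \<open>S'\<close> are the times at which the two orbits visit the base of the tower, and \<open>B\<close> is the
  set of times at which one of them is not typical.\<close>

lemma coding_impossible:
  fixes h b :: nat and m u v :: real and B S S' :: "nat set"
  assumes i: "i \<in> {1..d}" and m: "m \<ge> 8 / c" and b: "8 * close_const * b < c * h"
    and B: "finite B" "card B \<le> b"
    and \<rho>: "0 < \<rho>" "\<rho> \<le> c / (14 * h)" "v = u + \<rho>" "cross u \<rho> (6 * h)"
    and code: "\<And>t j. t \<in> S \<Longrightarrow> j < h \<Longrightarrow> t + j < 13 * h \<Longrightarrow> t + j \<notin> B \<Longrightarrow>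
        code j = (\<lfloor>m * frac (u + (t + j) * \<alpha>)\<rfloor>, lab u i (t + j))"
    and code': "\<And>t j. t \<in> S' \<Longrightarrow> j < h \<Longrightarrow> t + j < 13 * h \<Longrightarrow> t + j \<notin> B \<Longrightarrow>
        code j = (\<lfloor>m * frac (v + (t + j) * \<alpha>)\<rfloor>, lab v i (t + j))"
    and gap: "\<And>t t'. t \<in> S \<Longrightarrow> t' \<in> S \<Longrightarrow> t < t' \<Longrightarrow> t + h \<le> t'"
    and gap': "\<And>t t'. t \<in> S' \<Longrightarrow> t' \<in> S' \<Longrightarrow> t < t' \<Longrightarrow> t + h \<le> t'"
    and cover: "\<And>r. h \<le> r \<Longrightarrow> r < 13 * h \<Longrightarrow> r \<notin> B \<Longrightarrow> \<exists>t\<in>S. t \<le> r \<and> r < t + h"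
    and cover': "\<And>r. h \<le> r \<Longrightarrow> r < 13 * h \<Longrightarrow> r \<notin> B \<Longrightarrow> \<exists>t\<in>S'. t \<le> r \<and> r < t + h"
  shows False
proof -
  have "1 * real b \<le> close_const * b" using close_const_pos by (intro mult_right_mono) auto
  moreover have "c * h \<le> (1/4) * real h" using c by (intro mult_right_mono) auto
  ultimately have "32 * real b < h" using b by simp
  then have bh: "32 * b < h" by linarith
  \<comment> \<open>Of \<open>b + 1\<close> consecutive times one lies outside \<open>B\<close>, so
    a passage is met after waiting at most \<open>b\<close>.\<close>
  have visit: "\<exists>t\<in>S. t \<le> r + b \<and> r < t + h" "\<exists>t\<in>S'. t \<le> r + b \<and> r < t + h"
    if r: "h \<le> r" "r + b < 13 * h" for r
  proof -
    have "\<not> {r..r + b} \<subseteq> B"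
    proof
      assume "{r..r + b} \<subseteq> B"
      then have "card {r..r + b} \<le> card B" using B(1) by (intro card_mono) auto
      then show False using B(2) by simp
    qed
    then obtain r' where r': "r \<le> r'" "r' \<le> r + b" "r' \<notin> B" by (meson atLeastAtMost_iff subsetI)
    have r'': "h \<le> r'" "r' < 13 * h" using r r' by auto
    obtain t t' where t: "t \<in> S" "t \<le> r'" "r' < t + h" "t' \<in> S'" "t' \<le> r'" "r' < t' + h"
      using cover[OF r'' r'(3)] cover'[OF r'' r'(3)] by blast
    show "\<exists>t\<in>S. t \<le> r + b \<and> r < t + h" by (rule bexI[OF _ t(1)]) (use t r' in linarith)
    show "\<exists>t\<in>S'. t \<le> r + b \<and> r < t + h" by (rule bexI[OF _ t(4)]) (use t r' in linarith)
  qed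
  \<comment> \<open>Consecutive visits are between \<open>h\<close> and \<open>h + b\<close> apart,
    so the offset of the two orbits changes by at most \<open>b\<close> from one pair of visits to
    the next.\<close>
  have nextv: "\<exists>t'\<in>S. t + h \<le> t' \<and> t' \<le> t + h + b" if t: "t \<in> S" "t \<le> 11 * h" for t
  proof -
    obtain t' where t': "t' \<in> S" "t' \<le> t + h + b" "t + h < t' + h"
      using visit(1)[of "t + h"] t bh by auto
    then show ?thesis using gap[OF t(1) t'(1)] by auto
  qed
  have nextv': "\<exists>t'\<in>S'. t + h \<le> t' \<and> t' \<le> t + h + b" if t: "t \<in> S'" "t \<le> 11 * h" for t
  proof -
    obtain t' where t': "t' \<in> S'" "t' \<le> t + h + b" "t + h < t' + h"
      using visit(2)[of "t + h"] t bh by auto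
    then show ?thesis using gap'[OF t(1) t'(1)] by auto
  qed
  have close: "\<exists>n::int. \<bar>(real t - real t') * \<alpha> - n\<bar> < (close_const + c) / h"
    if t: "t \<in> S" "t' \<in> S'" "t \<le> 12 * h" "t' \<le> 12 * h" for t t'
  proof -
    obtain n :: int where n: "\<bar>u + t * \<alpha> - (v + t' * \<alpha>) - n\<bar> < close_const / h"
      by (rule visits_imp_close[OF i i m b B, of t code u t' v])
        (use code[OF t(1)] code'[OF t(2)] t in auto)
    have "c / (14 * h) \<le> c / h" using c bh by (intro divide_left_mono) auto
    then have "\<rho> \<le> c / h" using \<rho>(2) by linarith
    then show ?thesis using n \<rho>(1,3)
      by (intro exI[of _ n]) (simp add: add_divide_distrib abs_less_iff algebra_simps)
  qed
  have chain: "\<exists>t2\<in>S. \<exists>t2'\<in>S'. int t2 - int t2' = int t - int t' \<and> t + h \<le> t2 \<and> t2 \<le> t + h + b"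
    if t: "t \<in> S" "t' \<in> S'" "t \<le> 10 * h" "t' \<le> 10 * h" for t t'
  proof -
    obtain t2 t2' where t2: "t2 \<in> S" "t + h \<le> t2" "t2 \<le> t + h + b"
      "t2' \<in> S'" "t' + h \<le> t2'" "t2' \<le> t' + h + b"
      using nextv[OF t(1)] nextv'[OF t(2)] t(3,4) by auto
    obtain n n2 :: int where n: "\<bar>(real t - real t') * \<alpha> - n\<bar> < (close_const + c) / h"
      "\<bar>(real t2 - real t2') * \<alpha> - n2\<bar> < (close_const + c) / h"
      using close[OF t(1,2)] close[OF t2(1,4)] t2 t bh by auto
    have "int t2 - int t2' = int t - int t'"
    proof (rule ccontr)
      assume ne: "int t2 - int t2' \<noteq> int t - int t'"
      \<comment> \<open>A nonzero change \<open>s\<close> of the offset would put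
        \<open>s * \<alpha>\<close> within \<open>2 * (close_const + c) / h\<close> of an integer,
        whereas \<open>\<bar>s\<bar> \<le> b\<close> keeps it at least \<open>c / b\<close> away;
        the hypothesis on \<open>b\<close> makes these incompatible.\<close>
      define s where "s = (int t2 - int t2') - (int t - int t')"
      have s: "s \<noteq> 0" "\<bar>s\<bar> \<le> int b"
        using ne t2 unfolding s_def by auto
      have "c / b \<le> \<bar>s * \<alpha> - of_int (n2 - n)\<bar>"
        using s by (intro approx_int) auto
      also have "\<dots> < 2 * ((close_const + c) / h)"
      proof -
        have "s * \<alpha> - of_int (n2 - n) =
            ((real t2 - real t2') * \<alpha> - n2) - ((real t - real t') * \<alpha> - n)"
          unfolding s_def by (simp add: algebra_simps)
        then show ?thesis using n by linarith
      qed
      finally have "c * h < 2 * (close_const + c) * b"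
        using s bh by (simp add: field_simps)
      moreover have "2 * (close_const + c) * b \<le> 8 * close_const * b"
        using c close_const_pos by (intro mult_right_mono) auto
      ultimately show False using b by linarith
    qed
    then show ?thesis using t2 by blast
  qed
  have chains: "\<exists>t2\<in>S. \<exists>t2'\<in>S'. int t2 - int t2' = int t - int t' \<and> t + k * h \<le> t2 \<and> t2 \<le> t + k * (h + b)"
    if t: "t \<in> S" "t' \<in> S'" "t \<le> 4 * h" "t' \<le> 4 * h" "t \<le> t' + h" "t' \<le> t + h" "k \<le> 5" for t t' k
    using t(7)
  proof (induction k)
    case 0
    then show ?case using t by auto
  next
    case (Suc k)
    then obtain t2 t2' where t2: "t2 \<in> S" "t2' \<in> S'" "int t2 - int t2' = int t - int t'"
      "t + k * h \<le> t2" "t2 \<le> t + k * (h + b)" by auto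
    have "k * (h + b) \<le> 4 * (h + b)" using Suc.prems by (intro mult_right_mono) auto
    then have "t2 \<le> 10 * h" "t2' \<le> 10 * h" using t2 t bh by auto
    then obtain t3 t3' where "t3 \<in> S" "t3' \<in> S'" "int t3 - int t3' = int t2 - int t2'"
      "t2 + h \<le> t3" "t3 \<le> t2 + h + b" using chain[OF t2(1,2)] by auto
    then show ?case using t2 by (intro bexI[of _ t3] bexI[of _ t3']) auto
  qed
  obtain t where t: "t \<in> S" "2 * h < t + h" "t \<le> 2 * h + b"
    using visit(1)[of "2 * h"] bh by auto
  \<comment> \<open>Looking for \<open>t'\<close> around time \<open>t + h div 2\<close> bounds the
    offset by \<open>h / 2 + b\<close>, so that the passages from \<open>t\<close> and
    \<open>t'\<close> overlap in more than \<open>2 * b\<close> times.\<close>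
  have "h \<le> t + h div 2" "t + h div 2 + b < 13 * h"
    using t bh by linarith+
  then obtain t' where t': "t' \<in> S'" "t + h div 2 < t' + h" "t' \<le> t + h div 2 + b"
    using visit(2)[of "t + h div 2"] by auto
  have tt': "t \<le> 4 * h" "t' \<le> 4 * h" "t \<le> t' + h" "t' \<le> t + h"
    using t t' bh by linarith+
  \<comment> \<open>As \<open>t > h\<close>, five further visits lead past time
    \<open>6 * h\<close>, with the offset unchanged.\<close>
  obtain r r' where r: "r \<in> S" "r' \<in> S'" "int r - int r' = int t - int t'"
      "t + 5 * h \<le> r" "r \<le> t + 5 * (h + b)"
    using chains[OF t(1) t'(1), of 5] tt' by auto
  \<comment> \<open>\<open>{a..<a + k}\<close> consists of the levels \<open>j\<close> for which
    time \<open>t + j\<close> belongs to both passages; the second orbit is then on level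
    \<open>j'\<close>.\<close>
  define a where "a = nat (int t' - int t)"
  define k where "k = nat (int h - \<bar>int t - int t'\<bar>)"
  have "2 * card B < k"
    using t' bh B(2) t unfolding k_def by linarith
  then obtain j where j: "j \<in> {a..<a + k}" "t + j \<notin> B" "r + j \<notin> B"
    using exists_good_shift[OF B(1), of "{a..<a + k}" t r] by auto
  define j' where "j' = nat (int j + int t - int t')"
  have jh: "j < h" "j' < h" "t' + j' = t + j" "r' + j' = r + j"
    using j(1) r(3) unfolding a_def k_def j'_def by auto
  have past: "t + j < 6 * h" and future: "6 * h < r + j" "r + j < 13 * h"
    using t r jh bh by auto
  \<comment> \<open>Level \<open>j\<close> gives the first orbit the same label at times
    \<open>t + j\<close> and \<open>r + j\<close>, and level \<open>j'\<close> does so for the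
    second orbit. Yet the two orbits agree at the earlier time and differ at the later one.\<close>
  have "snd (code j) = lab u i (t + j)" "snd (code j) = lab u i (r + j)"
    using code[OF t(1) jh(1)] code[OF r(1) jh(1)] j past future by auto
  moreover have "snd (code j') = lab v i (t + j)" "snd (code j') = lab v i (r + j)"
    using code'[OF t'(1) jh(2)] code'[OF r(2) jh(2)] j past future by (auto simp: jh)
  \<comment> \<open>By the bound on \<rho>, a second crossing would be more than
    \<open>14 * h\<close> away from the one at \<open>6 * h\<close>.\<close>
  moreover have nc: "\<not> cross u \<rho> p" if "p \<noteq> 6 * h" "p < 13 * h" for p
  proof
    assume p: "cross u \<rho> p"
    define e where "e = (if p < 6 * h then 6 * h - p else p - 6 * h)"
    have e: "1 \<le> e" "e < 14 * h" using that by (auto simp: e_def)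
    have "c / e < \<rho>"
      using cross_gap[OF \<rho>(1,4) p] cross_gap[OF \<rho>(1) p \<rho>(4)] that(1)
      by (cases "p < 6 * h") (auto simp: e_def of_nat_diff)
    moreover have "c / (14 * h) \<le> c / e" using e c by (intro divide_left_mono) auto
    ultimately show False using \<rho>(2) by linarith
  qed
  have same: "lab u i p = lab v i p" if "p < 6 * h" for p
    using no_cross_interval[of 0 p u \<rho> i i] nc that by (simp add: \<rho>(3))
  have "lab u i (6 * h - 1 + 2) \<noteq> lab (u + \<rho>) i (6 * h - 1 + 2)"
    using bh nc[of "6 * h - 1"] nc[of "6 * h - 1 + 2"] same[of "6 * h - 1"] \<rho>(3,4)
    by (intro cross_step[OF \<rho>(1) _ _ _ i]) auto
  then have "lab u i (6 * h + 1) \<noteq> lab v i (6 * h + 1)" using bh by (simp add: \<rho>(3))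
  moreover have "lab u i (r + j) = lab v i (r + j) \<longleftrightarrow> lab u i (6 * h + 1) = lab v i (6 * h + 1)"
    unfolding \<rho>(3) by (rule no_cross_interval) (use nc future in auto)
  ultimately show False using same[OF past] by simp
qed

end

section \<open>Coding by Rokhlin towers\<close>

text \<open>The finite-valued function to be coded by the tower: it records the label, and the base
  point up to \<open>1 / m\<close>.\<close>

definition cell :: "nat \<Rightarrow> real \<times> nat \<Rightarrow> int \<times> nat" where
  "cell m = (\<lambda>(x, i). (\<lfloor>real m * x\<rfloor>, i))"

definition cell_set :: "nat \<Rightarrow> nat \<Rightarrow> int \<times> nat \<Rightarrow> (real \<times> nat) set" where
  "cell_set d m C = {p \<in> space (sti_space d). cell m p = C}"

lemma sets_sti_space: "sets (sti_space d) = sets (restrict_space lborel {0..<1} \<Otimes>\<^sub>M count_space {1..d})"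
  unfolding sti_space_def
  by (intro sets_pair_measure_cong) (simp_all add: sets_uniform_count_measure)

lemma Times_sti_space:
  assumes "A \<in> sets borel" "A \<subseteq> {0..<1}" "I \<subseteq> {1..d}"
  shows "A \<times> I \<in> sets (sti_space d)"
  unfolding sets_sti_space using assms
  by (intro pair_measureI) (auto simp: sets_restrict_space_iff)

lemma finite_measure_uniform_count_measure:
  fixes d :: nat
  assumes "d \<ge> 1"
  shows "finite_measure (uniform_count_measure {1..d})"
proof (rule finite_measureI)
  have "emeasure (uniform_count_measure {1..d}) {1..d} = 1"
    using assms by (subst emeasure_uniform_count_measure) auto
  then show "emeasure (uniform_count_measure {1..d}) (space (uniform_count_measure {1..d})) \<noteq> \<infinity>"
    by (simp only: space_uniform_count_measure) simp
qed

lemma emeasure_Times_sti_space: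
  assumes "A \<in> sets borel" "A \<subseteq> {0..<1}" "I \<subseteq> {1..d}" "d \<ge> 1"
  shows "emeasure (sti_space d) (A \<times> I) = emeasure lborel A * (card I / d)"
proof -
  interpret N: finite_measure "uniform_count_measure {1..d}" using assms(4) by (rule finite_measure_uniform_count_measure)
  have "emeasure (sti_space d) (A \<times> I) = emeasure (restrict_space lborel {0..<1}) A * emeasure (uniform_count_measure {1..d}) I"
    unfolding sti_space_def using assms
    by (intro N.emeasure_pair_measure_Times) (auto simp: sets_restrict_space_iff sets_uniform_count_measure)
  also have "emeasure (restrict_space lborel {0..<1}) A = emeasure lborel A"
    using assms by (subst emeasure_restrict_space) auto
  also have "emeasure (uniform_count_measure {1..d}) I = card I / d"
    using assms by (subst emeasure_uniform_count_measure) auto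
  finally show ?thesis .
qed

lemma cell_set_eq:
  assumes "m > 0"
  shows "cell_set d m (k, i) = ({k / m..<(real_of_int k + 1) / m} \<inter> {0..<1}) \<times> ({i} \<inter> {1..d})"
proof -
  have floor: "\<lfloor>real m * x\<rfloor> = k \<longleftrightarrow> x \<in> {k / m..<(real_of_int k + 1) / m}" for x
    using assms by (simp add: floor_eq_iff pos_divide_le_eq pos_less_divide_eq mult.commute)
  show ?thesis
  proof (rule set_eqI)
    fix p :: "real \<times> nat"
    obtain x j where p: "p = (x, j)" by fastforce
    have "p \<in> cell_set d m (k, i) \<longleftrightarrow> x \<in> {0..<1} \<and> j \<in> {1..d} \<and> \<lfloor>real m * x\<rfloor> = k \<and> j = i"
      by (simp add: cell_set_def cell_def space_sti_space p)
    then show "p \<in> cell_set d m (k, i) \<longleftrightarrow>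
        p \<in> ({k / m..<(real_of_int k + 1) / m} \<inter> {0..<1}) \<times> ({i} \<inter> {1..d})"
      unfolding floor p by blast
  qed
qed

lemma sets_cell_set:
  assumes "m > 0"
  shows "cell_set d m C \<in> sets (sti_space d)"
proof -
  obtain k i where C: "C = (k, i)" by fastforce
  show ?thesis unfolding C cell_set_eq[OF assms] by (intro Times_sti_space) auto
qed

lemma measure_cell_set_le:
  assumes "m > 0" "d \<ge> 1"
  shows "measure (sti_space d) (cell_set d m C) \<le> 1 / m"
proof -
  obtain k i where C: "C = (k, i)" by fastforce
  have "card ({i} \<inter> {1..d}) \<le> card {i}" by (intro card_mono) auto
  then have "card ({i} \<inter> {1..d}) / d \<le> 1 / d" by (intro divide_right_mono) auto
  also have "1 / real d \<le> 1" using assms(2) by simp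
  finally have card: "card ({i} \<inter> {1..d}) / d \<le> 1" .
  have "emeasure (sti_space d) (cell_set d m C) =
      emeasure lborel ({k / m..<(real_of_int k + 1) / m} \<inter> {0..<1}) * (card ({i} \<inter> {1..d}) / d)"
    unfolding C cell_set_eq[OF assms(1)] using assms(2) by (intro emeasure_Times_sti_space) auto
  also have "\<dots> \<le> emeasure lborel {k / m..<(real_of_int k + 1) / m} * 1"
    using card by (intro mult_mono emeasure_mono) auto
  also have "\<dots> = ennreal ((real_of_int k + 1) / m - k / m)"
    by (simp add: divide_right_mono)
  also have "(real_of_int k + 1) / m - k / m = 1 / m" by (simp add: diff_divide_distrib[symmetric])
  finally show ?thesis unfolding measure_def by (simp add: enn2real_leI)
qed

lemma finite_cells: "m > 0 \<Longrightarrow> finite (cell m ` space (sti_space d))"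
proof -
  assume m: "m > 0"
  have "cell m ` space (sti_space d) \<subseteq> {0..int m} \<times> {1..d}"
  proof
    fix C assume "C \<in> cell m ` space (sti_space d)"
    then obtain x :: real and i where x: "0 \<le> x" "x < 1" "i \<in> {1..d}" "C = (\<lfloor>m * x\<rfloor>, i)"
      unfolding space_sti_space by (auto simp: cell_def)
    have "real m * x \<le> real m * 1" "0 \<le> real m * x" using x by (auto intro: mult_left_le)
    then have "\<lfloor>real m * x\<rfloor> \<le> int m" "0 \<le> \<lfloor>real m * x\<rfloor>" by linarith+
    then show "C \<in> {0..int m} \<times> {1..d}" using x(3,4) by simp
  qed
  then show ?thesis by (rule finite_subset) auto
qed

text \<open>Approximate each class of \<open>f\<close> by a union of atoms, with total error below
  \<epsilon>. Off the union \<open>E\<close> of the errors, \<open>f\<close> is constant on every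
  atom. The complement of the tower is itself an atom, so apart from \<open>E\<close> it lies in a
  single class, of measure at most \<delta>; hence the tower covers almost everything.\<close>

lemma rank_one_coding:
  assumes "finite_measure M" "rank_one M T" "finite (f ` space M)"
    and f: "\<And>C. {p \<in> space M. f p = C} \<in> sets M" "\<And>C. measure M {p \<in> space M. f p = C} \<le> \<delta>"
    and "\<epsilon> > 0" "\<delta> \<ge> 0"
  obtains F h N code where "rokhlin_tower M T F h" "N \<in> sets M" "measure M N < \<delta> + \<epsilon>"
    "\<And>p. p \<in> space M - N \<Longrightarrow> \<exists>j<h. p \<in> (T ^^ j) ` F \<and> f p = code j"
proof -
  interpret finite_measure M by (rule assms(1))
  obtain F h where tower: "\<And>n. rokhlin_tower M T (F n) (h n)"
    and gen: "\<forall>A\<in>sets M. \<exists>S. (\<forall>n. S n \<subseteq> tower_partition M T (F n) (h n)) \<and>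
          (\<lambda>n. measure M (sym_diff A (\<Union>(S n)))) \<longlonglongrightarrow> 0"
    using assms(2) unfolding rank_one_def by blast
  define cls where "cls C = {p \<in> space M. f p = C}" for C
  have "\<forall>C. \<exists>S. (\<forall>n. S n \<subseteq> tower_partition M T (F n) (h n)) \<and>
          (\<lambda>n. measure M (sym_diff (cls C) (\<Union>(S n)))) \<longlonglongrightarrow> 0"
    unfolding cls_def by (intro allI bspec[OF gen] f(1))
  from choice[OF this] obtain S where
    *: "\<forall>C. (\<forall>n. S C n \<subseteq> tower_partition M T (F n) (h n)) \<and>
          (\<lambda>n. measure M (sym_diff (cls C) (\<Union>(S C n)))) \<longlonglongrightarrow> 0" ..
  have S: "S C n \<subseteq> tower_partition M T (F n) (h n)"
    "(\<lambda>n. measure M (sym_diff (cls C) (\<Union>(S C n)))) \<longlonglongrightarrow> 0" for C n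
    using spec[OF *, of C] by (blast, blast)
  have "(\<lambda>n. \<Sum>C\<in>f ` space M. measure M (sym_diff (cls C) (\<Union>(S C n)))) \<longlonglongrightarrow> (\<Sum>C\<in>f ` space M. 0)"
    by (intro tendsto_sum S(2))
  then have "\<forall>\<^sub>F n in sequentially. (\<Sum>C\<in>f ` space M. measure M (sym_diff (cls C) (\<Union>(S C n)))) < \<epsilon>"
    using assms(6) by (intro order_tendstoD(2)) auto
  then obtain n where n: "(\<Sum>C\<in>f ` space M. measure M (sym_diff (cls C) (\<Union>(S C n)))) < \<epsilon>"
    by (auto simp: eventually_sequentially)
  define L where "L j = (T ^^ j) ` F n" for j
  define R where "R = space M - (\<Union>j<h n. L j)"
  define E where "E = (\<Union>C\<in>f ` space M. sym_diff (cls C) (\<Union>(S C n)))"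
  have part: "tower_partition M T (F n) (h n) = insert R (L ` {..<h n})"
    by (simp add: tower_partition_def R_def L_def)
  have L: "L j \<in> sets M" if "j < h n" for j
    using tower[of n] that by (auto simp: rokhlin_tower_def L_def)
  have Rsets: "R \<in> sets M" unfolding R_def using L by auto
  have US: "\<Union>(S C n) \<in> sets M" for C
  proof (rule sets.countable_Union)
    show "countable (S C n)"
      using S(1)[of C n] unfolding part by (rule countable_subset) auto
    show "S C n \<subseteq> sets M" using S(1)[of C n] L Rsets unfolding part by auto
  qed
  have D: "sym_diff (cls C) (\<Union>(S C n)) \<in> sets M" for C
    using US f(1) by (auto simp: cls_def)
  have E: "E \<in> sets M" unfolding E_def using D assms(3) by (intro sets.finite_UN) auto
  have "measure M E \<le> (\<Sum>C\<in>f ` space M. measure M (sym_diff (cls C) (\<Union>(S C n))))"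
    unfolding E_def using D assms(3) by (intro finite_measure_subadditive_finite) auto
  then have mE: "measure M E < \<epsilon>" using n by linarith
  have LL: "L j \<inter> L k = {}" if "j < h n" "k < h n" "j \<noteq> k" for j k
    using tower[of n] that unfolding rokhlin_tower_def L_def disjoint_family_on_def by auto
  have disj: "A \<inter> A' = {}" if A: "A \<in> insert R (L ` {..<h n})" "A' \<in> insert R (L ` {..<h n})" "A \<noteq> A'" for A A'
  proof -
    consider "A = R" | "A' = R" | j k where "A = L j" "A' = L k" "j < h n" "k < h n"
      using A(1,2) by blast
    then show ?thesis
    proof cases
      case 3
      then show ?thesis using LL[of j k] A(3) by metis
    qed (use A in \<open>auto simp: R_def\<close>)
  qed
  \<comment> \<open>Off \<open>E\<close>, the point \<open>p\<close> lies in a member of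
    \<open>S (f p) n\<close>, which by disjointness is \<open>A\<close>; then a point
    \<open>q\<close> of \<open>A\<close> off \<open>E\<close> lies in the class of
    \<open>f p\<close>.\<close>
  have atom: "f q = f p" if "p \<in> space M - E" "q \<in> space M - E" "A \<in> insert R (L ` {..<h n})" "p \<in> A" "q \<in> A" for p q A
  proof -
    have "p \<in> \<Union>(S (f p) n)" using that(1) by (auto simp: E_def cls_def)
    then obtain A' where A': "A' \<in> S (f p) n" "p \<in> A'" by blast
    then have A'2: "A' \<in> insert R (L ` {..<h n})" using S(1)[of "f p" n] part by auto
    have "A' = A"
    proof (rule ccontr)
      assume "A' \<noteq> A"
      then have "A' \<inter> A = {}" using A'2 that(3) disj by metis
      then show False using that(4) A'(2) by blast
    qed
    then have "q \<in> \<Union>(S (f p) n)" using A'(1) that(5) by blast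
    then show ?thesis using that(1,2) by (auto simp: E_def cls_def)
  qed
  have "\<exists>C. R - E \<subseteq> cls C"
  proof (cases "R - E = {}")
    case False
    then obtain p where "p \<in> R - E" by blast
    moreover have "R \<subseteq> space M" by (auto simp: R_def)
    ultimately have "R - E \<subseteq> cls (f p)" using atom[of p _ R] by (auto simp: cls_def)
    then show ?thesis ..
  qed auto
  then obtain C where "R - E \<subseteq> cls C" by blast
  then have ER: "E \<union> R \<subseteq> E \<union> cls C" by blast
  have cls: "cls C \<in> sets M" unfolding cls_def by (rule f(1))
  have "measure M (E \<union> R) \<le> measure M (E \<union> cls C)"
    using E cls by (intro finite_measure_mono ER) blast
  moreover have "measure M (E \<union> cls C) \<le> measure M E + measure M (cls C)"
    by (intro measure_Un_le E cls)
  ultimately have m: "measure M (E \<union> R) < \<delta> + \<epsilon>"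
    using mE f(2)[of C] by (simp add: cls_def)
  \<comment> \<open>If level \<open>j\<close> has no point outside \<open>E\<close> the value is
    arbitrary, but then no point considered below lies on it.\<close>
  define code where "code j = f (SOME p. p \<in> L j \<inter> (space M - E))" for j
  show thesis
  proof (rule that[OF tower[of n] _ m])
    show "E \<union> R \<in> sets M" using E Rsets by blast
    fix p assume p: "p \<in> space M - (E \<union> R)"
    then obtain j where j: "j < h n" "p \<in> L j" unfolding R_def by blast
    then have "\<exists>p. p \<in> L j \<inter> (space M - E)" using p by blast
    from someI_ex[OF this] have "(SOME p. p \<in> L j \<inter> (space M - E)) \<in> L j \<inter> (space M - E)" .
    then have "f p = code j"
      unfolding code_def using p j by (intro atom[of _ p "L j"]) auto
    then show "\<exists>j<h n. p \<in> (T ^^ j) ` F n \<and> f p = code j"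
      using j by (auto simp: L_def)
  qed
qed

section \<open>Averaging over base points\<close>

lemma rotation_measure_le:
  fixes N :: "real set" and s :: real
  assumes "N \<in> sets borel" "N \<subseteq> {0..<1}"
  defines "P \<equiv> {x \<in> {0..<1}. frac (x + s) \<in> N}"
  shows "P \<in> sets borel" "emeasure lborel P \<le> emeasure lborel N"
proof -
  define r where "r = frac s"
  have r: "0 \<le> r" "r < 1" by (auto simp: r_def frac_lt_1)
  have fr: "frac (x + s) = (if x < 1 - r then x + r else x + r - 1)" if "x \<in> {0..<1}" for x
  proof -
    have "frac x = x" using that by (simp add: frac_eq)
    then show ?thesis unfolding r_def using frac_add[of x s] by auto
  qed
  have tr: "(\<lambda>x. x + a) -` B \<in> sets borel" if "B \<in> sets borel" for a and B :: "real set"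
  proof -
    have "(\<lambda>x. x + a) \<in> borel_measurable (borel :: real measure)" by simp
    from measurable_sets[OF this that] show ?thesis by simp
  qed
  have mtr: "emeasure lborel ((\<lambda>x. x + a) -` B) = emeasure lborel B" if "B \<in> sets borel" for a and B :: "real set"
  proof -
    have "emeasure lborel B = emeasure (distr lborel borel ((+) a)) B"
      using lborel_distr_plus[of a] by simp
    also have "\<dots> = emeasure lborel ((+) a -` B)" using that by (subst emeasure_distr) auto
    also have "(+) a -` B = (\<lambda>x. x + a) -` B" by (auto simp: add.commute)
    finally show ?thesis by simp
  qed
  \<comment> \<open>Cutting \<open>N\<close> at \<open>r\<close> turns the rotation into two
    translations, which preserve Lebesgue measure.\<close>
  define N1 N2 where "N1 = N \<inter> {r..<1}" and "N2 = N \<inter> {0..<r}"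
  have N12: "N1 \<in> sets borel" "N2 \<in> sets borel" "N1 \<inter> N2 = {}" "N = N1 \<union> N2"
    using assms(1,2) by (auto simp: N1_def N2_def)
  have P: "P = (\<lambda>x. x + r) -` N1 \<union> (\<lambda>x. x + (r - 1)) -` N2"
  proof (intro equalityI subsetI)
    fix x assume "x \<in> P"
    then have x: "x \<in> {0..<1}" "frac (x + s) \<in> N" by (auto simp: P_def)
    then show "x \<in> (\<lambda>x. x + r) -` N1 \<union> (\<lambda>x. x + (r - 1)) -` N2"
    proof (cases "x < 1 - r")
      case True
      then show ?thesis using fr[OF x(1)] x r by (simp add: N1_def)
    next
      case False
      then have "x + (r - 1) \<in> N" using fr[OF x(1)] x(2) by (simp add: add_diff_eq)
      then show ?thesis using False x(1) by (simp add: N2_def)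
    qed
  next
    fix x assume "x \<in> (\<lambda>x. x + r) -` N1 \<union> (\<lambda>x. x + (r - 1)) -` N2"
    then have "x \<in> {0..<1}" "x < 1 - r \<and> x + r \<in> N \<or> \<not> x < 1 - r \<and> x + r - 1 \<in> N"
      using r by (auto simp: N1_def N2_def algebra_simps)
    then show "x \<in> P" unfolding P_def using fr[of x] by auto
  qed
  show "P \<in> sets borel" unfolding P using tr N12 by blast
  have "emeasure lborel P \<le> emeasure lborel ((\<lambda>x. x + r) -` N1) + emeasure lborel ((\<lambda>x. x + (r - 1)) -` N2)"
    unfolding P using tr N12 by (intro emeasure_subadditive) auto
  also have "\<dots> = emeasure lborel N1 + emeasure lborel N2" using mtr N12 by simp
  also have "\<dots> = emeasure lborel N" using N12 by (subst plus_emeasure) auto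
  finally show "emeasure lborel P \<le> emeasure lborel N" .
qed

text \<open>The integral of the count over \<open>x\<close> is the sum of the measures of the
  rotated sets, at most \<open>card I * measure lborel N\<close>; some \<open>x\<close> does no
  worse than the average.\<close>

lemma exists_few_returns:
  fixes N :: "real set" and s :: "'a \<Rightarrow> real"
  assumes "N \<in> sets borel" "N \<subseteq> {0..<1}" "finite I"
  obtains x where "x \<in> {0..<1}" "card {t \<in> I. frac (x + s t) \<in> N} \<le> card I * measure lborel N"
proof -
  define P where "P t = {x \<in> {0..<1}. frac (x + s t) \<in> N}" for t
  have P: "P t \<in> sets borel" "emeasure lborel (P t) \<le> emeasure lborel N" for t
    unfolding P_def using rotation_measure_le[OF assms(1,2)] by auto
  have "emeasure lborel N \<le> emeasure lborel {0..<1::real}"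
    using assms(2) by (intro emeasure_mono) auto
  then have Nfin: "emeasure lborel N = ennreal (measure lborel N)"
    by (intro emeasure_eq_ennreal_measure) (auto simp: top_unique)
  have "\<exists>x\<in>{0..<1}. real (card {t \<in> I. frac (x + s t) \<in> N}) \<le> card I * measure lborel N"
  proof (rule ccontr)
    assume "\<not> ?thesis"
    then have neg: "\<And>x. x \<in> {0..<1} \<Longrightarrow> card I * measure lborel N < card {t \<in> I. frac (x + s t) \<in> N}"
      by force
    \<comment> \<open>The least integer above the average. Were all counts above the average, they
      would be at least \<open>K\<close>, and a non-strict comparison of integrals already gives a
      contradiction.\<close>
    define K where "K = nat \<lfloor>card I * measure lborel N\<rfloor> + 1"
    have le: "K \<le> card {t \<in> I. frac (x + s t) \<in> N}" if "x \<in> {0..<1}" for x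
    proof -
      have "\<lfloor>card I * measure lborel N\<rfloor> < int (card {t \<in> I. frac (x + s t) \<in> N})"
        using neg[OF that] by (simp add: floor_less_iff)
      moreover have "0 \<le> card I * measure lborel N" by simp
      then have "0 \<le> \<lfloor>card I * measure lborel N\<rfloor>" by (simp only: zero_le_floor)
      ultimately show ?thesis unfolding K_def by linarith
    qed
    have "of_nat K = (\<integral>\<^sup>+x. of_nat K * indicator {0..<1::real} x \<partial>lborel)"
      by (subst nn_integral_cmult_indicator) auto
    also have "\<dots> \<le> (\<integral>\<^sup>+x. (\<Sum>t\<in>I. indicator (P t) x) \<partial>lborel)"
    proof (intro nn_integral_mono)
      fix x :: real
      have sum: "(\<Sum>t\<in>I. indicator (P t) x :: ennreal) = of_nat (card {t \<in> I. x \<in> P t})"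
        using assms(3) by (simp add: indicator_def sum.If_cases Int_def)
      show "of_nat K * indicator {0..<1::real} x \<le> (\<Sum>t\<in>I. indicator (P t) x :: ennreal)"
      proof (cases "x \<in> {0..<1}")
        case True
        then have "{t \<in> I. x \<in> P t} = {t \<in> I. frac (x + s t) \<in> N}" by (auto simp: P_def)
        then show ?thesis unfolding sum using le[OF True] True by (simp add: of_nat_mono)
      qed simp
    qed
    also have "\<dots> = (\<Sum>t\<in>I. emeasure lborel (P t))"
      using P(1) by (subst nn_integral_sum) auto
    also have "\<dots> \<le> (\<Sum>t\<in>I. emeasure lborel N)" by (intro sum_mono P(2))
    also have "\<dots> = ennreal (card I * measure lborel N)"
      by (simp add: Nfin ennreal_mult ennreal_of_nat_eq_real_of_nat)
    finally have "ennreal K \<le> ennreal (card I * measure lborel N)"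
      by (simp add: ennreal_of_nat_eq_real_of_nat)
    then have "K \<le> card I * measure lborel N"
      by (subst (asm) ennreal_le_iff) auto
    then have "K \<le> nat \<lfloor>card I * measure lborel N\<rfloor>" by (simp add: le_nat_floor)
    then show False by (simp add: K_def)
  qed
  then show thesis using that by blast
qed

section \<open>Visits of an orbit to the base of a tower\<close>

lemma funpow_inj_on:
  assumes "inj_on T X" "T ` X \<subseteq> X"
  shows "inj_on (T ^^ n) X" "(T ^^ n) ` X \<subseteq> X"
proof (induction n)
  case (Suc n)
  {
    case 1
    have "inj_on T ((T ^^ n) ` X)" using assms(1) Suc(2) by (rule inj_on_subset)
    then show ?case using comp_inj_on[OF Suc(1)] by (simp add: comp_def)
  next
    case 2
    show ?case using Suc(2) assms(2) by (auto simp: image_subset_iff)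
  }
qed auto

text \<open>The first two claims follow from the disjointness of the levels. The third cancels
  \<open>T ^^ k\<close> by injectivity; \<open>h \<le> r\<close> ensures that the subtraction
  \<open>r - k\<close> is not truncated.\<close>

lemma tower_visits:
  assumes tower: "rokhlin_tower M T F h" and T: "inj_on T (space M)" "T ` space M \<subseteq> space M"
    and z: "z \<in> space M"
  shows "(T ^^ t) z \<in> F \<Longrightarrow> (T ^^ t') z \<in> F \<Longrightarrow> t < t' \<Longrightarrow> t + h \<le> t'"
    and "(T ^^ t) z \<in> F \<Longrightarrow> j < h \<Longrightarrow> k < h \<Longrightarrow> (T ^^ (t + j)) z \<in> (T ^^ k) ` F \<Longrightarrow> k = j"
    and "k < h \<Longrightarrow> h \<le> r \<Longrightarrow> (T ^^ r) z \<in> (T ^^ k) ` F \<Longrightarrow> (T ^^ (r - k)) z \<in> F"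
proof -
  have disj: "j = k" if "j < h" "k < h" "p \<in> (T ^^ j) ` F" "p \<in> (T ^^ k) ` F" for j k p
  proof (rule ccontr)
    assume "j \<noteq> k"
    then have "(T ^^ j) ` F \<inter> (T ^^ k) ` F = {}"
      using tower that(1,2) unfolding rokhlin_tower_def disjoint_family_on_def by blast
    then show False using that(3,4) by blast
  qed
  have split: "(T ^^ (t + j)) z = (T ^^ j) ((T ^^ t) z)" for t j
    by (simp add: funpow_add add.commute[of t])
  show unique: "k = j" if "(T ^^ t) z \<in> F" "j < h" "k < h" "(T ^^ (t + j)) z \<in> (T ^^ k) ` F" for t j k
    using disj[OF that(3,2,4)] that(1) unfolding split by blast
  show "t + h \<le> t'" if "(T ^^ t) z \<in> F" "(T ^^ t') z \<in> F" "t < t'"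
  proof (rule ccontr)
    assume "\<not> t + h \<le> t'"
    then have "t' - t < h" "0 < h" using that(3) by linarith+
    then have "0 = t' - t" using unique[of t "t' - t" 0] that by simp
    then show False using that(3) by simp
  qed
  show "(T ^^ (r - k)) z \<in> F" if r: "k < h" "h \<le> r" "(T ^^ r) z \<in> (T ^^ k) ` F"
  proof -
    have "F \<in> sets M" using tower by (auto simp: rokhlin_tower_def dest: spec[of _ 0])
    then have F: "F \<subseteq> space M" by (rule sets.sets_into_space)
    obtain q where q: "q \<in> F" "(T ^^ r) z = (T ^^ k) q" using r(3) by blast
    have "(T ^^ k) ((T ^^ (r - k)) z) = (T ^^ k) q"
      using split[of "r - k" k] q(2) r(1,2) by simp
    moreover have "(T ^^ (r - k)) z \<in> space M" using funpow_inj_on(2)[OF T] z by blast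
    ultimately have "(T ^^ (r - k)) z = q"
      using inj_onD[OF funpow_inj_on(1)[OF T]] F q(1) by blast
    then show ?thesis using q(1) by simp
  qed
qed

text \<open>A base point outside \<open>P\<close> is typical whatever its label, so averaging over
  the base suffices. One factor \<open>d\<close> comes from the weight \<open>1 / d\<close> of each
  label, the other from the union over the labels.\<close>

lemma measure_base_projection_le:
  assumes "d \<ge> 1" "N \<in> sets (sti_space d)"
  defines "P \<equiv> {y. \<exists>i\<in>{1..d}. (y, i) \<in> N}"
  shows "P \<in> sets borel" "P \<subseteq> {0..<1}" "measure lborel P \<le> (real d)\<^sup>2 * measure (sti_space d) N"
proof -
  define Q where "Q i = (\<lambda>y. (y, i)) -` N" for i
  have P: "P = (\<Union>i\<in>{1..d}. Q i)" by (auto simp: P_def Q_def)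
  have "Q i \<in> sets (restrict_space lborel {0..<1})" for i
    using sets_Pair2[of N "restrict_space lborel {0..<1}" "count_space {1..d}" i] assms(2)
    unfolding sets_sti_space Q_def by simp
  then have Q: "Q i \<in> sets borel" "Q i \<subseteq> {0..<1}" for i
    by (auto simp: sets_restrict_space_iff)
  show "P \<in> sets borel" "P \<subseteq> {0..<1}" unfolding P using Q by auto
  have fin: "emeasure lborel (Q i) \<noteq> \<infinity>" for i
  proof -
    have "emeasure lborel (Q i) \<le> emeasure lborel {0..<1::real}"
      using Q by (intro emeasure_mono) auto
    then show ?thesis by (auto simp: top_unique)
  qed
  have "emeasure (sti_space d) (space (sti_space d)) = 1" using assms(1) by (rule emeasure_sti_space)
  then interpret finite_measure "sti_space d" by (intro finite_measureI) auto
  have le: "measure lborel (Q i) \<le> d * measure (sti_space d) N" if "i \<in> {1..d}" for i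
  proof -
    have "emeasure (sti_space d) (Q i \<times> {i}) = emeasure lborel (Q i) * (card {i} / d)"
      using Q that assms(1) by (intro emeasure_Times_sti_space) auto
    then have "measure (sti_space d) (Q i \<times> {i}) = measure lborel (Q i) * (1 / d)"
      unfolding measure_def by (simp add: enn2real_mult)
    moreover have "measure (sti_space d) (Q i \<times> {i}) \<le> measure (sti_space d) N"
      using assms(2) by (intro finite_measure_mono) (auto simp: Q_def)
    moreover have "measure lborel (Q i) = d * (measure lborel (Q i) * (1 / d))"
      using assms(1) by simp
    ultimately show ?thesis by (metis mult_left_mono of_nat_0_le_iff)
  qed
  have "measure lborel P \<le> (\<Sum>i\<in>{1..d}. measure lborel (Q i))"
    unfolding P using Q fin by (intro measure_UNION_le) auto
  also have "\<dots> \<le> (\<Sum>i\<in>{1..d}. d * measure (sti_space d) N)" by (intro sum_mono le)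
  also have "\<dots> = (real d)\<^sup>2 * measure (sti_space d) N" by (simp add: power2_eq_square)
  finally show "measure lborel P \<le> (real d)\<^sup>2 * measure (sti_space d) N" .
qed

context badly_approximable_sti
begin

lemma sti_map_inj_on_image:
  shows "inj_on (sti_map \<alpha> \<tau> \<sigma>) (space (sti_space d))"
    and "sti_map \<alpha> \<tau> \<sigma> ` space (sti_space d) \<subseteq> space (sti_space d)"
proof -
  have inj: "inj \<tau>" "inj \<sigma>" using tiling permutes_inj unfolding square_tiling_def by auto
  show "inj_on (sti_map \<alpha> \<tau> \<sigma>) (space (sti_space d))"
  proof (rule inj_onI)
    fix p q assume pq: "p \<in> space (sti_space d)" "q \<in> space (sti_space d)"
      "sti_map \<alpha> \<tau> \<sigma> p = sti_map \<alpha> \<tau> \<sigma> q"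
    obtain x i y k where p: "p = (x, i)" "q = (y, k)" by fastforce
    have x: "0 \<le> x" "x < 1" "0 \<le> y" "y < 1" using pq(1,2) by (auto simp: p space_sti_space)
    have fr: "frac (x + \<alpha>) = frac (y + \<alpha>)" using pq(3) by (simp add: p sti_map_def)
    then have "x - y = real_of_int (\<lfloor>x + \<alpha>\<rfloor> - \<lfloor>y + \<alpha>\<rfloor>)" by (simp add: frac_def)
    moreover from this have "\<bar>real_of_int (\<lfloor>x + \<alpha>\<rfloor> - \<lfloor>y + \<alpha>\<rfloor>)\<bar> < 1" using x by linarith
    then have "\<lfloor>x + \<alpha>\<rfloor> - \<lfloor>y + \<alpha>\<rfloor> = 0" by linarith
    ultimately have "x = y" by simp
    then show "p = q" using pq(3) inj by (auto simp: p sti_map_def inj_eq split: if_splits)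
  qed
  have "sti_map \<alpha> \<tau> \<sigma> (x, i) \<in> {0..<1} \<times> {1..d}" if "i \<in> {1..d}" for x i
    using that tiling permutes_in_image[of \<tau> "{1..d}"] permutes_in_image[of \<sigma> "{1..d}"]
    unfolding square_tiling_def sti_map_def by (simp add: frac_lt_1 del: atLeastAtMost_iff)
  then show "sti_map \<alpha> \<tau> \<sigma> ` space (sti_space d) \<subseteq> space (sti_space d)"
    unfolding space_sti_space by blast
qed

text \<open>Supplies, for one orbit, the hypotheses of \<open>coding_impossible\<close>: visits are
  spaced, passages follow the code at typical times, and typical times are covered.\<close>

lemma tower_coding:
  fixes m t t' j r :: nat and u :: real
  assumes tower: "rokhlin_tower (sti_space d) (sti_map \<alpha> \<tau> \<sigma>) F h" and i: "i \<in> {1..d}"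
    and code: "\<And>p. p \<in> space (sti_space d) - N \<Longrightarrow>
        \<exists>j<h. p \<in> (sti_map \<alpha> \<tau> \<sigma> ^^ j) ` F \<and> cell m p = code j"
  defines "S \<equiv> {t. (sti_map \<alpha> \<tau> \<sigma> ^^ t) (frac u, i) \<in> F}"
    and "P \<equiv> {y. \<exists>i\<in>{1..d}. (y, i) \<in> N}"
  shows "t \<in> S \<Longrightarrow> t' \<in> S \<Longrightarrow> t < t' \<Longrightarrow> t + h \<le> t'"
    and "t \<in> S \<Longrightarrow> j < h \<Longrightarrow> frac (u + real (t + j) * \<alpha>) \<notin> P \<Longrightarrow>
        code j = (\<lfloor>m * frac (u + real (t + j) * \<alpha>)\<rfloor>, lab u i (t + j))"
    and "h \<le> r \<Longrightarrow> frac (u + r * \<alpha>) \<notin> P \<Longrightarrow> \<exists>t\<in>S. t \<le> r \<and> r < t + h"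
proof -
  have z: "(frac u, i) \<in> space (sti_space d)" using i by (simp add: space_sti_space frac_lt_1)
  note visits = tower_visits[OF tower sti_map_inj_on_image z]
  have level: "\<exists>k<h. (sti_map \<alpha> \<tau> \<sigma> ^^ r) (frac u, i) \<in> (sti_map \<alpha> \<tau> \<sigma> ^^ k) ` F \<and>
      code k = (\<lfloor>m * frac (u + r * \<alpha>)\<rfloor>, lab u i r)" if "frac (u + r * \<alpha>) \<notin> P" for r
  proof -
    have "(frac (u + r * \<alpha>), lab u i r) \<in> space (sti_space d) - N"
      using that lab_in[OF i, of u r] by (auto simp: P_def space_sti_space frac_lt_1)
    from code[OF this] show ?thesis unfolding funpow_sti_map[OF \<alpha>] by (auto simp: cell_def)
  qed
  show "t + h \<le> t'" if "t \<in> S" "t' \<in> S" "t < t'"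
    using visits(1) that by (simp add: S_def)
  show "code j = (\<lfloor>m * frac (u + real (t + j) * \<alpha>)\<rfloor>, lab u i (t + j))"
    if j: "t \<in> S" "j < h" "frac (u + real (t + j) * \<alpha>) \<notin> P"
  proof -
    obtain k where k: "k < h" "(sti_map \<alpha> \<tau> \<sigma> ^^ (t + j)) (frac u, i) \<in> (sti_map \<alpha> \<tau> \<sigma> ^^ k) ` F"
      "code k = (\<lfloor>m * frac (u + real (t + j) * \<alpha>)\<rfloor>, lab u i (t + j))"
      using level[of "t + j"] j(3) by auto
    then have "k = j" using visits(2) j(1,2) by (simp add: S_def)
    then show ?thesis using k(3) by simp
  qed
  show "\<exists>t\<in>S. t \<le> r \<and> r < t + h" if r: "h \<le> r" "frac (u + r * \<alpha>) \<notin> P"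
  proof -
    obtain k where k: "k < h" "(sti_map \<alpha> \<tau> \<sigma> ^^ r) (frac u, i) \<in> (sti_map \<alpha> \<tau> \<sigma> ^^ k) ` F"
      using level[OF r(2)] by blast
    then have "r - k \<in> S" using visits(3) r(1) by (simp add: S_def)
    then show ?thesis using k(1) r(1) by (intro bexI[of _ "r - k"]) auto
  qed
qed

section \<open>Choice of the constants and of the two orbits\<close>

lemma not_rank_one: "\<not> rank_one (sti_space d) (sti_map \<alpha> \<tau> \<sigma>)"
proof
  let ?T = "sti_map \<alpha> \<tau> \<sigma>"
  assume rank: "rank_one (sti_space d) ?T"
  have d: "d \<ge> 1" using tiling by (simp add: square_tiling_def)
  then have i: "1 \<in> {1..d}" by simp
  \<comment> \<open>\<open>K * h\<close> bounds the horizon \<open>H\<close> below: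
    \<open>14 * h * hit_const / c\<close> steps to reach a crossing, and \<open>13 * h\<close> steps
    of observation.\<close>
  define K where "K = 13 + 14 * hit_const / c"
  have K: "K > 0" using c by (simp add: K_def hit_const_def add_pos_pos)
  \<comment> \<open>Makes \<open>8 * close_const * card B < c * h\<close> in the end:
    \<open>card B\<close> is at most \<open>2 * K * h * d\<^sup>2\<close> times the measure of
    \<open>N\<close>, which is below \<eta>.\<close>
  define \<eta> where "\<eta> = c / (16 * close_const * K * d\<^sup>2)"
  have \<eta>: "\<eta> > 0" using c K close_const_pos d by (simp add: \<eta>_def)
  \<comment> \<open>The bound \<open>8 / c\<close> is the fineness that
    \<open>coding_impossible\<close> asks for; \<open>2 / \<eta>\<close> makes each cell of measure
    at most \<open>\<eta> / 2\<close>.\<close>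
  obtain m :: nat where m: "real m > max (8 / c) (2 / \<eta>)" using reals_Archimedean2 by blast
  have "8 / c > 0" using c by simp
  then have m0: "m > 0" "m \<ge> 8 / c" using m by (auto intro!: gr0I)
  have "2 / \<eta> \<le> m" using m by simp
  then have m\<eta>: "1 / m \<le> \<eta> / 2" using \<eta> m0(1) by (simp add: divide_simps mult.commute)
  have "emeasure (sti_space d) (space (sti_space d)) = 1" using d by (rule emeasure_sti_space)
  then have fin: "finite_measure (sti_space d)" by (intro finite_measureI) auto
  obtain F h N code where tower: "rokhlin_tower (sti_space d) ?T F h"
    and N: "N \<in> sets (sti_space d)" "measure (sti_space d) N < 1 / m + \<eta> / 2"
    and code: "\<And>p. p \<in> space (sti_space d) - N \<Longrightarrow> \<exists>j<h. p \<in> (?T ^^ j) ` F \<and> cell m p = code j"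
  proof (rule rank_one_coding[OF fin rank finite_cells[OF m0(1)], of "1 / m" "\<eta> / 2"])
    show "{p \<in> space (sti_space d). cell m p = C} \<in> sets (sti_space d)" for C
      using sets_cell_set[OF m0(1)] by (simp add: cell_set_def)
    show "measure (sti_space d) {p \<in> space (sti_space d). cell m p = C} \<le> 1 / m" for C
      using measure_cell_set_le[OF m0(1) d] by (simp add: cell_set_def)
  qed (use \<eta> in auto)
  have h: "h > 0" using tower by (simp add: rokhlin_tower_def)
  define P where "P = {y. \<exists>i\<in>{1..d}. (y, i) \<in> N}"
  note P = measure_base_projection_le[OF d N(1), folded P_def]
  define \<rho> where "\<rho> = c / (14 * h)"
  have \<rho>: "\<rho> > 0" "\<rho> \<le> 1" using c h by (auto simp: \<rho>_def field_simps)
  define H where "H = nat \<lfloor>hit_const / \<rho>\<rfloor> + 13 * h"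
  have "hit_const / \<rho> \<ge> 0" using \<rho> c by (simp add: hit_const_def)
  then have "H \<le> hit_const / \<rho> + 13 * h" by (simp add: H_def)
  also have "\<dots> = K * h" using c h by (simp add: K_def \<rho>_def field_simps)
  finally have H: "H \<le> K * h" .
  \<comment> \<open>The shift \<open>j\<close> depends on \<open>x\<close>, so \<open>x\<close> is
    chosen first, with few atypical times for both orbits up to \<open>H\<close>; this contains the
    window of length \<open>13 * h\<close> from every possible \<open>j\<close>.\<close>
  define I where "I = {..<H} \<times> {0, \<rho>}"
  define s where "s = (\<lambda>(t, e). e + real t * \<alpha>)"
  obtain x where x: "real (card {p \<in> I. frac (x + s p) \<in> P}) \<le> card I * measure lborel P"
    using exists_few_returns[OF P(1,2), of I s] by (auto simp: I_def)
  \<comment> \<open>Advancing the starting point of the search by \<open>6 * h\<close> steps places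
    the crossing at time \<open>6 * h\<close> of the orbit of \<open>u\<close>.\<close>
  obtain j :: nat and n :: int where j: "j \<le> hit_const / \<rho>" "x + (6 * h) * \<alpha> + j * \<alpha> < n"
    "n \<le> x + (6 * h) * \<alpha> + \<rho> + j * \<alpha>"
    using hits_arc[OF \<rho>, of "x + (6 * h) * \<alpha>"] by blast
  have jH: "j + r < H" if "r < 13 * h" for r
    using j(1) that by (simp add: H_def le_nat_floor add_le_less_mono)
  define u v where "u = x + j * \<alpha>" and "v = u + \<rho>"
  define B where "B = {r. r < 13 * h \<and> (frac (u + r * \<alpha>) \<in> P \<or> frac (v + r * \<alpha>) \<in> P)}"
  have "B \<subseteq> (\<lambda>(t, e). t - j) ` {p \<in> I. frac (x + s p) \<in> P}"
  proof
    fix r assume r: "r \<in> B"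
    have "x + s (j + r, 0) = u + r * \<alpha>" "x + s (j + r, \<rho>) = v + r * \<alpha>"
      by (simp_all add: s_def u_def v_def algebra_simps)
    then have "(j + r, 0) \<in> {p \<in> I. frac (x + s p) \<in> P} \<or> (j + r, \<rho>) \<in> {p \<in> I. frac (x + s p) \<in> P}"
      using r jH by (auto simp: B_def I_def)
    then show "r \<in> (\<lambda>(t, e). t - j) ` {p \<in> I. frac (x + s p) \<in> P}" by force
  qed
  then have "card B \<le> card {p \<in> I. frac (x + s p) \<in> P}"
    by (rule surj_card_le[rotated]) (simp add: I_def)
  then have "real (card B) \<le> card I * measure lborel P" using x by linarith
  also have "\<dots> \<le> (2 * H) * (d\<^sup>2 * measure (sti_space d) N)"
    using P(3) \<rho>(1) by (intro mult_mono) (auto simp: I_def card_cartesian_product)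
  also have "\<dots> \<le> (2 * (K * h)) * (d\<^sup>2 * measure (sti_space d) N)"
    using H by (intro mult_right_mono) auto
  finally have "8 * close_const * card B \<le> 8 * close_const * ((2 * (K * h)) * (d\<^sup>2 * measure (sti_space d) N))"
    using close_const_pos by (intro mult_left_mono) auto
  also have "\<dots> = (16 * close_const * K * d\<^sup>2 * h) * measure (sti_space d) N" by simp
  also have "\<dots> < (16 * close_const * K * d\<^sup>2 * h) * \<eta>"
    using N(2) m\<eta> close_const_pos K h d by (intro mult_strict_left_mono mult_pos_pos) auto
  also have "\<dots> = c * h" using close_const_pos K d by (simp add: \<eta>_def)
  finally have B: "8 * close_const * card B < c * h" .
  have cross: "cross u \<rho> (6 * h)"
    unfolding crosses_iff[OF \<rho>(1)] u_def using j(2,3)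
    by (intro exI[of _ n]) (simp add: algebra_simps)
  have finB: "finite B" by (simp add: B_def)
  have \<rho>c: "\<rho> \<le> c / (14 * h)" by (simp add: \<rho>_def)
  have good: "frac (u + r * \<alpha>) \<notin> P" "frac (v + r * \<alpha>) \<notin> P" if "r < 13 * h" "r \<notin> B" for r
    using that by (auto simp: B_def)
  define S where "S w = {t. (?T ^^ t) (frac w, 1) \<in> F}" for w
  note coding = tower_coding[OF tower i, where N = N and m = m and code = code, OF code, folded P_def S_def]
  have gap: "t + h \<le> t'" if "t \<in> S w" "t' \<in> S w" "t < t'" for w t t'
    using coding(1) that by blast
  have code_S: "code k = (\<lfloor>real m * frac (w + (real t + real k) * \<alpha>)\<rfloor>, lab w 1 (t + k))"
    if "w \<in> {u, v}" "t \<in> S w" "k < h" "t + k < 13 * h" "t + k \<notin> B" for w t k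
    using coding(2)[where t = t and u = w and j = k] that good[of "t + k"] by auto
  have cover: "\<exists>t\<in>S w. t \<le> r \<and> r < t + h"
    if "w \<in> {u, v}" "h \<le> r" "r < 13 * h" "r \<notin> B" for w r
    using coding(3)[where r = r and u = w] that good[of r] by blast
  show False
    by (rule coding_impossible[OF i m0(2) B finB order.refl \<rho>(1) \<rho>c v_def cross,
          where S = "S u" and S' = "S v" and code = code])
      (fact gap | rule code_S cover; simp)+
qed

end

theorem theorem3:
  fixes d :: nat and \<tau> \<sigma> :: "nat \<Rightarrow> nat" and \<alpha> :: real
  assumes "square_tiling d \<tau> \<sigma>"
    and "connected_surface d \<tau> \<sigma>"
    and "vertices d \<tau> \<sigma> \<subseteq> singularities d \<tau> \<sigma>"
    and "0 < \<alpha>" "\<alpha> < 1" "\<alpha> \<notin> \<rat>"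
    and "bounded_partial_quotients \<alpha>"
  shows "\<not> rank_one (sti_space d) (sti_map \<alpha> \<tau> \<sigma>)"
proof -
  obtain c :: real where c: "0 < c" "c \<le> 1/4"
    "\<And>(k::nat) (n::int). k \<ge> 1 \<Longrightarrow> c / k \<le> \<bar>k * \<alpha> - n\<bar>"
    using bounded_partial_quotients_imp_badly_approximable[OF assms(6,7)] by blast
  interpret badly_approximable_sti \<alpha> c d \<tau> \<sigma>
  proof
    show "\<tau> (\<sigma> i) \<noteq> \<sigma> (\<tau> i)" if "i \<in> {1..d}" for i
      using assms(3) that unfolding vertices_singular_iff[OF assms(1)] by blast
  qed (use c assms in auto)
  show ?thesis by (rule not_rank_one)
qed

end
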